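(* Let $k$ be an arbitrary infinite field (of any characteristic), and let $e$ be a positive integer. There exists a sequence $h=(1,h_1,\dots,h_{e-1},h_e=1)$ of socle degree $e$ which is the $h$-vector of a standard graded artinian Gorenstein $k$-algebra, is unimodal, and is not an SI-sequence, if and only if $e\ge 6$.
   Context: A standard graded artinian $k$-algebra is $A=R/I=\bigoplus_{i\ge 0}[A]_i$, where $R=k[x_1,\dots,x_r]$ has the standard grading and $I$ is a homogeneous ideal with $\dim_k A<\infty$; one assumes that $I$ contains no nonzero forms of degree $1$, and $r$ is called the codimension of $A$. The $h$-vector of $A$ is $h=(1,h_1,\dots,h_e)$, where $h_i=\dim_k[A]_i$ and $e$, the socle degree of $A$, is the last index with $h_e>0$ (so $h_1=r$). The socle of $A$ is $\{a\in A: a\overline{\mathfrak m}=0\}$, where $\overline{\mathfrak m}=(\overline{x_1},\dots,\overline{x_r})$. $A$ is level of type $t$ if its socle is a $t$-dimensional $k$-vector space concentrated in degree $e$, and $A$ is Gorenstein if it is level of type $1$. A Gorenstein $h$-vector is the $h$-vector of a Gorenstein algebra. A sequence is unimodal if it never increases strictly after a strict decrease. A sequence $h=(1,h_1,\dots,h_e)$ is symmetric if $h_i=h_{e-i}$ for all $i$. A sequence $(1,h_1,\dots,h_m)$ is differentiable if its first difference $(1,h_1-1,h_2-h_1,\dots,h_m-h_{m-1})$ is, after discarding any trailing zeros, the $h$-vector of some standard graded artinian algebra. A sequence $h=(1,h_1,\dots,h_e)$ is an SI-sequence (satisfies the Stanley-Iarrobino property) if it is symmetric and its first half $(1,h_1,\dots,h_{\lfloor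 e/2\rfloor})$ is differentiable. *)

theory Defs
  imports
    "HOL-Library.Poly_Mapping"
    "HOL-Library.More_List"
    "HOL-Algebra.QuotRing"
    "HOL-Algebra.Embedded_Algebras"
begin

section \<open>The polynomial ring $k[x_0,\dots,x_{r-1}]$\<close>

text \<open>Monomials are finitely supported exponent vectors; the variables are indexed from 0.\<close>

type_synonym 'k mpoly = "(nat \<Rightarrow>\<^sub>0 nat) \<Rightarrow>\<^sub>0 'k"

definition mpoly_ring :: "nat \<Rightarrow> ('k::field) mpoly ring" where
  "mpoly_ring r =
     \<lparr>carrier = {p. \<forall>m\<in>Poly_Mapping.keys p. Poly_Mapping.keys m \<subseteq> {..<r}},
      mult = (*), one = 1, zero = 0, add = (+)\<rparr>"

definition mono_degree :: "(nat \<Rightarrow>\<^sub>0 nat) \<Rightarrow> nat" where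
  "mono_degree m = (\<Sum>j\<in>Poly_Mapping.keys m. Poly_Mapping.lookup m j)"

text \<open>The zero polynomial is a form of every degree.\<close>

definition forms :: "nat \<Rightarrow> nat \<Rightarrow> ('k::field) mpoly set" where
  "forms r i =
     {p \<in> carrier (mpoly_ring r). \<forall>m\<in>Poly_Mapping.keys p. mono_degree m = i}"

definition const :: "'k::field \<Rightarrow> 'k mpoly" where
  "const c = Poly_Mapping.single 0 c"

definition var :: "nat \<Rightarrow> ('k::field) mpoly" where
  "var j = Poly_Mapping.single (Poly_Mapping.single j 1) 1"

lemma mpoly_ring_cring: "cring (mpoly_ring r :: ('k::field) mpoly ring)"
proof (rule cringI)
  let ?R = "mpoly_ring r :: 'k mpoly ring"
  have add: "p + q \<in> carrier ?R" if "p \<in> carrier ?R" "q \<in> carrier ?R" for p q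
    using that Poly_Mapping.keys_add[of p q] unfolding mpoly_ring_def by fastforce
  have mult: "p * q \<in> carrier ?R" if "p \<in> carrier ?R" "q \<in> carrier ?R" for p q
  proof -
    have "Poly_Mapping.keys m \<subseteq> {..<r}" if m: "m \<in> Poly_Mapping.keys (p * q)" for m
    proof -
      obtain a b where "m = a + b" "a \<in> Poly_Mapping.keys p" "b \<in> Poly_Mapping.keys q"
        using m keys_mult[of p q] by blast
      moreover from this have "Poly_Mapping.keys a \<subseteq> {..<r}" "Poly_Mapping.keys b \<subseteq> {..<r}"
        using \<open>p \<in> carrier ?R\<close> \<open>q \<in> carrier ?R\<close> by (simp_all add: mpoly_ring_def)
      ultimately show ?thesis
        using Poly_Mapping.keys_add[of a b] by blast
    qed
    then show ?thesis by (simp add: mpoly_ring_def)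
  qed
  have ops: "x \<oplus>\<^bsub>?R\<^esub> y = x + y" "x \<otimes>\<^bsub>?R\<^esub> y = x * y" "\<zero>\<^bsub>?R\<^esub> = 0" "\<one>\<^bsub>?R\<^esub> = 1" for x y
    by (simp_all add: mpoly_ring_def)
  have units: "0 \<in> carrier ?R" "1 \<in> carrier ?R"
    by (simp_all add: mpoly_ring_def)
  have inverse: "\<exists>q\<in>carrier ?R. q + p = 0" if "p \<in> carrier ?R" for p
    by (rule bexI[of _ "- p"]) (use that in \<open>simp_all add: mpoly_ring_def\<close>)
  show "abelian_group ?R"
    by (rule abelian_groupI; unfold ops) (auto simp: add units inverse add.assoc intro: add.commute)
  show "comm_monoid ?R"
    by (rule comm_monoidI; unfold ops) (auto simp: mult units mult.assoc intro: mult.commute)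
  show "(x \<oplus>\<^bsub>?R\<^esub> y) \<otimes>\<^bsub>?R\<^esub> z = x \<otimes>\<^bsub>?R\<^esub> z \<oplus>\<^bsub>?R\<^esub> y \<otimes>\<^bsub>?R\<^esub> z" for x y z
    by (simp add: ops distrib_right)
qed


section \<open>Standard graded artinian algebras\<close>

text \<open>
  The algebra $A = R/I$ is the quotient ring \<open>alg r I\<close>, whose elements are cosets of \<open>I\<close>. The
  field $k$ acts on it through the subfield \<open>scalars r I\<close> of $A$, the image of the constants, so
  that dimensions over $k$ are the dimensions over this subfield in the sense of
  \<^theory>\<open>HOL-Algebra.Embedded_Algebras\<close>.
\<close>

definition alg :: "nat \<Rightarrow> ('k::field) mpoly set \<Rightarrow> 'k mpoly set ring" where
  "alg r I = mpoly_ring r Quot I"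

definition proj :: "nat \<Rightarrow> ('k::field) mpoly set \<Rightarrow> 'k mpoly \<Rightarrow> 'k mpoly set" where
  "proj r I p = I +>\<^bsub>mpoly_ring r\<^esub> p"

definition scalars :: "nat \<Rightarrow> ('k::field) mpoly set \<Rightarrow> 'k mpoly set set" where
  "scalars r I = proj r I ` range const"

definition graded_part :: "nat \<Rightarrow> ('k::field) mpoly set \<Rightarrow> nat \<Rightarrow> 'k mpoly set set" where
  "graded_part r I i = proj r I ` forms r i"

definition homogeneous_ideal :: "nat \<Rightarrow> ('k::field) mpoly set \<Rightarrow> bool" where
  "homogeneous_ideal r I \<longleftrightarrow> (\<exists>F \<subseteq> (\<Union>d. forms r d). I = Idl\<^bsub>mpoly_ring r\<^esub> F)"

text \<open>
  The ideal is proper because $h$-vectors start with $h_0 = 1$. The codimension $r$ may be 0, in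
  which case $A = k$.
\<close>

definition standard_graded_artinian :: "nat \<Rightarrow> ('k::field) mpoly set \<Rightarrow> bool" where
  "standard_graded_artinian r I \<longleftrightarrow>
     homogeneous_ideal r I \<and> I \<noteq> carrier (mpoly_ring r) \<and>
     ring.finite_dimension (alg r I) (scalars r I) (carrier (alg r I)) \<and>
     I \<inter> forms r 1 = {0}"

definition hilbert_function :: "nat \<Rightarrow> ('k::field) mpoly set \<Rightarrow> nat \<Rightarrow> nat" where
  "hilbert_function r I i = ring.dim (alg r I) (scalars r I) (graded_part r I i)"

definition socle_degree :: "nat \<Rightarrow> ('k::field) mpoly set \<Rightarrow> nat" where
  "socle_degree r I = (GREATEST i. hilbert_function r I i > 0)"

text \<open>A sequence $(h_0,\dots,h_e)$ is represented by a list of length $e + 1$.\<close>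

definition h_vector :: "nat \<Rightarrow> ('k::field) mpoly set \<Rightarrow> nat list" where
  "h_vector r I = map (hilbert_function r I) [0..<Suc (socle_degree r I)]"

definition max_ideal :: "nat \<Rightarrow> ('k::field) mpoly set \<Rightarrow> 'k mpoly set set" where
  "max_ideal r I = Idl\<^bsub>alg r I\<^esub> (proj r I ` var ` {..<r})"

definition socle :: "nat \<Rightarrow> ('k::field) mpoly set \<Rightarrow> 'k mpoly set set" where
  "socle r I = {a \<in> carrier (alg r I).
     \<forall>b\<in>max_ideal r I. a \<otimes>\<^bsub>alg r I\<^esub> b = \<zero>\<^bsub>alg r I\<^esub>}"

definition level :: "nat \<Rightarrow> ('k::field) mpoly set \<Rightarrow> nat \<Rightarrow> bool" where
  "level r I t \<longleftrightarrow>
     ring.dimension (alg r I) t (scalars r I) (socle r I) \<and>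
     socle r I \<subseteq> graded_part r I (socle_degree r I)"

definition gorenstein :: "nat \<Rightarrow> ('k::field) mpoly set \<Rightarrow> bool" where
  "gorenstein r I \<longleftrightarrow> level r I 1"


section \<open>Properties of sequences\<close>

definition is_h_vector :: "'k::field itself \<Rightarrow> nat list \<Rightarrow> bool" where
  "is_h_vector K h \<longleftrightarrow>
     (\<exists>r (I :: 'k mpoly set). standard_graded_artinian r I \<and> h = h_vector r I)"

definition gorenstein_h_vector :: "'k::field itself \<Rightarrow> nat list \<Rightarrow> bool" where
  "gorenstein_h_vector K h \<longleftrightarrow>
     (\<exists>r (I :: 'k mpoly set). standard_graded_artinian r I \<and> gorenstein r I \<and> h = h_vector r I)"

definition unimodal_seq :: "nat list \<Rightarrow> bool" where
  "unimodal_seq h \<longleftrightarrow>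
     (\<forall>i j. i < j \<longrightarrow> Suc j < length h \<longrightarrow> h ! i > h ! Suc i \<longrightarrow> \<not> h ! j < h ! Suc j)"

definition symmetric_seq :: "nat list \<Rightarrow> bool" where
  "symmetric_seq h \<longleftrightarrow> (\<forall>i < length h. h ! i = h ! (length h - 1 - i))"

definition first_difference :: "nat list \<Rightarrow> int list" where
  "first_difference h =
     map (\<lambda>i. if i = 0 then int (h ! 0) else int (h ! i) - int (h ! (i - 1))) [0..<length h]"

definition differentiable_seq :: "'k::field itself \<Rightarrow> nat list \<Rightarrow> bool" where
  "differentiable_seq K h \<longleftrightarrow>
     (\<exists>g. is_h_vector K g \<and> strip_while (\<lambda>x. x = 0) (first_difference h) = map int g)"

definition SI_sequence :: "'k::field itself \<Rightarrow> nat list \<Rightarrow> bool" where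
  "SI_sequence K h \<longleftrightarrow>
     symmetric_seq h \<and> differentiable_seq K (take (Suc ((length h - 1) div 2)) h)"

end

theory Submission
  imports Defs
begin

text \<open>
  For \<open>e \<le> 5\<close>, symmetry (the socle pairing \<open>A\<^sub>i \<times> A\<^sub>e\<^sub>-\<^sub>i \<rightarrow> A\<^sub>e\<close> is perfect) and unimodality leave only
  the first half \<open>(1, h\<^sub>1, h\<^sub>2)\<close> with \<open>1 \<le> h\<^sub>1 \<le> h\<^sub>2\<close> to consider. The only remaining constraint on
  \<open>(1, h\<^sub>1 - 1, h\<^sub>2 - h\<^sub>1)\<close> is the number of quadratic monomials, and it follows from the bound on
  \<open>h\<^sub>2\<close> since only \<open>h\<^sub>1\<close> quadratic monomials in \<open>h\<^sub>1\<close> variables involve the last variable.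

  For \<open>e \<ge> 6\<close>, let \<open>D\<close> be the order ideal generated by the monomials \<open>x\<^sup>a y\<^sup>b z\<^sup>c\<close> of degree \<open>e - 1\<close> with
  \<open>c \<le> 2\<close>, together with \<open>x\<^bsup>e-4\<^esup> z\<^sup>3\<close>. It is pure with \<open>3 i\<close> monomials in degrees \<open>i = 1, 2\<close> and
  \<open>3 i + 1\<close> monomials in degrees \<open>3 \<le> i \<le> e - 1\<close>. The trivial extension of the level algebra spanned by
  \<open>D\<close> is Gorenstein with \<open>h\<^sub>i = |D\<^sub>i| + |D\<^sub>e\<^sub>-\<^sub>i|\<close>, that is,
  \<open>(1, 3e+1, 3e+1, 3e+2, \<dots>, 3e+2, 3e+1, 3e+1, 1)\<close>. Its first difference \<open>(1, 3e, 0, 1, \<dots>)\<close> vanishes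
  in degree 2 but not in degree 3.
\<close>

section \<open>Monomials and polynomials\<close>

definition monoms :: "nat \<Rightarrow> (nat \<Rightarrow>\<^sub>0 nat) set" where
  "monoms r = {m. Poly_Mapping.keys m \<subseteq> {..<r}}"

definition monoms_deg :: "nat \<Rightarrow> nat \<Rightarrow> (nat \<Rightarrow>\<^sub>0 nat) set" where
  "monoms_deg r i = {m \<in> monoms r. mono_degree m = i}"

lemma mono_degree_eq_sum:
  assumes "finite A" "Poly_Mapping.keys m \<subseteq> A"
  shows "mono_degree m = (\<Sum>j\<in>A. Poly_Mapping.lookup m j)"
  unfolding mono_degree_def
  by (rule sum.mono_neutral_left) (use assms in \<open>auto simp: in_keys_iff\<close>)

lemma mono_degree_add: "mono_degree (m + n) = mono_degree m + mono_degree n"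
proof -
  let ?A = "Poly_Mapping.keys m \<union> Poly_Mapping.keys n"
  have "mono_degree (m + n) = (\<Sum>j\<in>?A. Poly_Mapping.lookup (m + n) j)"
    by (rule mono_degree_eq_sum) (use Poly_Mapping.keys_add[of m n] in auto)
  also have "\<dots> = mono_degree m + mono_degree n"
    using mono_degree_eq_sum[of ?A m] mono_degree_eq_sum[of ?A n]
    by (simp add: lookup_add sum.distrib)
  finally show ?thesis .
qed

lemma mono_degree_single [simp]: "mono_degree (Poly_Mapping.single j k) = k"
  by (simp add: mono_degree_def)

lemma mono_degree_zero [simp]: "mono_degree 0 = 0"
  by (simp add: mono_degree_def)

lemma mono_degree_eq_0_iff [simp]: "mono_degree m = 0 \<longleftrightarrow> m = 0"
  by (auto simp: mono_degree_def in_keys_iff intro!: poly_mapping_eqI)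

lemma zero_in_monoms [simp]: "0 \<in> monoms r"
  by (simp add: monoms_def)

lemma single_in_monoms [simp]: "j < r \<Longrightarrow> Poly_Mapping.single j k \<in> monoms r"
  by (simp add: monoms_def)

lemma keys_add_nat:
  "Poly_Mapping.keys (m + n :: 'a \<Rightarrow>\<^sub>0 nat) = Poly_Mapping.keys m \<union> Poly_Mapping.keys n"
  by (auto simp: in_keys_iff lookup_add)

lemma add_in_monoms_iff [simp]: "m + n \<in> monoms r \<longleftrightarrow> m \<in> monoms r \<and> n \<in> monoms r"
  by (simp add: monoms_def keys_add_nat)

lemma monoms_deg_subset: "monoms_deg r i \<subseteq> monoms r"
  by (auto simp: monoms_deg_def)

lemma monoms_deg_0 [simp]: "monoms_deg r 0 = {0}"
  by (auto simp: monoms_deg_def)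

lemma add_in_monoms_deg:
  "m \<in> monoms_deg r i \<Longrightarrow> n \<in> monoms_deg r j \<Longrightarrow> m + n \<in> monoms_deg r (i + j)"
  by (simp add: monoms_deg_def mono_degree_add)

lemma single_in_monoms_deg: "j < r \<Longrightarrow> Poly_Mapping.single j k \<in> monoms_deg r k"
  by (simp add: monoms_deg_def)

lemma mono_split_var:
  assumes "j \<in> Poly_Mapping.keys (m :: nat \<Rightarrow>\<^sub>0 nat)"
  obtains n where "m = Poly_Mapping.single j 1 + n"
proof
  show "m = Poly_Mapping.single j 1 + (m - Poly_Mapping.single j 1)"
    using assms
    by (intro poly_mapping_eqI) (auto simp: lookup_add lookup_minus lookup_single when_def in_keys_iff)
qed

lemma monoms_deg_Suc:
  assumes "m \<in> monoms_deg r (Suc i)"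
  obtains j n where "j < r" "n \<in> monoms_deg r i" "m = Poly_Mapping.single j 1 + n"
proof -
  from assms have m: "m \<in> monoms r" "mono_degree m = Suc i"
    by (auto simp: monoms_deg_def)
  then have "m \<noteq> 0" by auto
  then obtain j where j: "j \<in> Poly_Mapping.keys m"
    by (metis keys_eq_empty ex_in_conv)
  then obtain n where n: "m = Poly_Mapping.single j 1 + n"
    by (rule mono_split_var)
  show thesis
  proof (rule that)
    show "j < r" using j m by (auto simp: monoms_def)
    show "n \<in> monoms_deg r i"
      using m unfolding n by (simp add: monoms_deg_def mono_degree_add)
  qed (fact n)
qed

lemma finite_monoms_deg [simp]: "finite (monoms_deg r i)"
proof (induction i)
  case (Suc i)
  have "monoms_deg r (Suc i) \<subseteq> (\<lambda>(j, n). Poly_Mapping.single j 1 + n) ` ({..<r} \<times> monoms_deg r i)"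
    by (force elim: monoms_deg_Suc)
  then show ?case
    by (rule finite_subset) (simp add: Suc)
qed simp

lemma monoms_deg_1: "monoms_deg r 1 = (\<lambda>j. Poly_Mapping.single j 1) ` {..<r}"
proof
  show "monoms_deg r 1 \<subseteq> (\<lambda>j. Poly_Mapping.single j 1) ` {..<r}"
  proof
    fix m assume "m \<in> monoms_deg r 1"
    then obtain j n where "j < r" "n \<in> monoms_deg r 0" "m = Poly_Mapping.single j 1 + n"
      using monoms_deg_Suc[of m r 0] by (metis One_nat_def)
    then show "m \<in> (\<lambda>j. Poly_Mapping.single j 1) ` {..<r}" by auto
  qed
qed (auto simp: single_in_monoms_deg)

lemma single_one_eq_iff [simp]:
  "Poly_Mapping.single i (1::nat) = Poly_Mapping.single j 1 \<longleftrightarrow> i = j"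
  by (metis keys_single one_neq_zero singleton_inject)

lemma single_Suc_0_eq_iff [simp]:
  "Poly_Mapping.single i (Suc 0) = Poly_Mapping.single j (Suc 0) \<longleftrightarrow> i = j"
  using single_one_eq_iff by simp

section \<open>Polynomials and forms through the monomials occurring in them\<close>

lemma mem_carrier_iff: "p \<in> carrier (mpoly_ring r) \<longleftrightarrow> Poly_Mapping.keys p \<subseteq> monoms r"
  by (auto simp: mpoly_ring_def monoms_def)

lemma mem_forms_iff: "p \<in> forms r i \<longleftrightarrow> Poly_Mapping.keys p \<subseteq> monoms_deg r i"
  by (auto simp: forms_def mem_carrier_iff monoms_deg_def)

lemma mpoly_ring_simps [simp]:
  "x \<oplus>\<^bsub>mpoly_ring r\<^esub> y = x + y" "x \<otimes>\<^bsub>mpoly_ring r\<^esub> y = x * y"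
  "\<zero>\<^bsub>mpoly_ring r\<^esub> = 0" "\<one>\<^bsub>mpoly_ring r\<^esub> = 1"
  by (simp_all add: mpoly_ring_def)

lemma poly_mapping_sum_single:
  fixes p :: "'a \<Rightarrow>\<^sub>0 'b::comm_monoid_add"
  shows "p = (\<Sum>m\<in>Poly_Mapping.keys p. Poly_Mapping.single m (Poly_Mapping.lookup p m))"
  by (rule poly_mapping_eqI)
    (simp add: lookup_sum lookup_single when_def in_keys_iff)

text \<open>A polynomial is the sum of its terms, so an additive statement only has to be checked on
  single terms. The set \<open>X\<close> records which monomials are allowed: all of them for
  identities, those of one degree for statements about forms.\<close>

lemma poly_mapping_induct_keys [consumes 1, case_names zero single add]:
  fixes p :: "'a \<Rightarrow>\<^sub>0 'b::comm_monoid_add"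
  assumes "Poly_Mapping.keys p \<subseteq> X"
    and "P 0"
    and "\<And>m k. m \<in> X \<Longrightarrow> P (Poly_Mapping.single m k)"
    and "\<And>p q. P p \<Longrightarrow> P q \<Longrightarrow> P (p + q)"
  shows "P p"
proof -
  have "P (\<Sum>m\<in>Y. Poly_Mapping.single m (Poly_Mapping.lookup p m))" if "finite Y" "Y \<subseteq> X" for Y
    using that by (induction Y rule: finite_induct) (use assms in auto)
  from this[of "Poly_Mapping.keys p"] show ?thesis
    using assms(1) poly_mapping_sum_single[of p] by simp
qed

lemma uminus_eq_const_mult: "- p = const (-1) * (p :: 'k::field mpoly)"
  by (simp add: const_def single_uminus)

lemma const_0 [simp]: "const 0 = 0" and const_1 [simp]: "const 1 = 1"
  by (simp_all add: const_def)

lemma const_add: "const (a + b) = const a + const b"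
  and const_uminus: "const (- a) = - const a"
  and const_mult: "const (a * b) = const a * const b"
  by (simp_all add: const_def single_add single_uminus mult_single)

lemma const_mult_single: "const c * Poly_Mapping.single m k = Poly_Mapping.single m (c * k)"
  by (simp add: const_def mult_single)

lemma lookup_const_mult: "Poly_Mapping.lookup (const c * p) m = c * Poly_Mapping.lookup p m"
  by (rule poly_mapping_induct_keys[of p UNIV])
    (simp_all add: const_mult_single lookup_single when_def lookup_add algebra_simps)

lemma keys_const_mult: "Poly_Mapping.keys (const c * p) \<subseteq> Poly_Mapping.keys p"
  by (auto simp: in_keys_iff lookup_const_mult)

lemma const_in_carrier [simp]: "const c \<in> carrier (mpoly_ring r)"
  by (simp add: const_def mem_carrier_iff)

lemma const_mult_in_forms [simp]: "p \<in> forms r i \<Longrightarrow> const c * p \<in> forms r i"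
  using keys_const_mult[of c p] by (auto simp: mem_forms_iff)

lemma zero_in_forms [simp]: "0 \<in> forms r i"
  by (simp add: mem_forms_iff)

lemma add_in_forms [simp]: "p \<in> forms r i \<Longrightarrow> q \<in> forms r i \<Longrightarrow> p + q \<in> forms r i"
  using Poly_Mapping.keys_add[of p q] by (auto simp: mem_forms_iff)

lemma sum_in_forms: "(\<And>x. x \<in> X \<Longrightarrow> f x \<in> forms r i) \<Longrightarrow> (\<Sum>x\<in>X. f x) \<in> forms r i"
  by (induction X rule: infinite_finite_induct) auto

lemma single_in_forms [simp]: "m \<in> monoms_deg r i \<Longrightarrow> Poly_Mapping.single m k \<in> forms r i"
  by (simp add: mem_forms_iff)

lemma forms_subset_carrier: "forms r i \<subseteq> carrier (mpoly_ring r)"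
  by (auto simp: forms_def)

lemma mult_in_forms: "p \<in> forms r i \<Longrightarrow> q \<in> forms r j \<Longrightarrow> p * q \<in> forms r (i + j)"
  using keys_mult[of p q] add_in_monoms_deg by (fastforce simp: mem_forms_iff)

lemma var_in_forms: "j < r \<Longrightarrow> var j \<in> forms r 1"
  by (simp add: var_def single_in_monoms_deg)

lemma one_in_forms: "1 \<in> forms r 0"
  by (simp add: mem_forms_iff)

section \<open>Homogeneous components\<close>

definition component :: "nat \<Rightarrow> ('k::field) mpoly \<Rightarrow> 'k mpoly" where
  "component d p =
     (\<Sum>m | m \<in> Poly_Mapping.keys p \<and> mono_degree m = d. Poly_Mapping.single m (Poly_Mapping.lookup p m))"

lemma lookup_component:
  "Poly_Mapping.lookup (component d p) m = (if mono_degree m = d then Poly_Mapping.lookup p m else 0)"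
  by (auto simp: component_def lookup_sum lookup_single when_def in_keys_iff sum.delta')

lemma component_add: "component d (p + q) = component d p + component d q"
  by (rule poly_mapping_eqI) (simp add: lookup_component lookup_add)

lemma component_0 [simp]: "component d 0 = 0"
  by (rule poly_mapping_eqI) (simp add: lookup_component)

lemma component_single:
  "component d (Poly_Mapping.single m k) = (if mono_degree m = d then Poly_Mapping.single m k else 0)"
  by (rule poly_mapping_eqI) (auto simp add: lookup_component lookup_single when_def)

text \<open>A term shifts degrees by \<open>mono_degree m\<close>. The guard excludes the degrees
  below that, where truncated subtraction would wrongly pick out the constant part of
  \<open>p\<close>.\<close>

lemma component_single_mult:
  "component d (Poly_Mapping.single m k * p) =
     (if mono_degree m \<le> d then Poly_Mapping.single m k * component (d - mono_degree m) p else 0)"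
  by (rule poly_mapping_induct_keys[of p UNIV])
    (auto simp: component_single mult_single mono_degree_add component_add distrib_left)

lemma component_in_forms: "p \<in> carrier (mpoly_ring r) \<Longrightarrow> component d p \<in> forms r d"
  by (auto simp: mem_carrier_iff mem_forms_iff monoms_deg_def in_keys_iff lookup_component split: if_splits)

lemma component_form: "p \<in> forms r i \<Longrightarrow> component d p = (if d = i then p else 0)"
  by (rule poly_mapping_eqI) (auto simp: lookup_component mem_forms_iff monoms_deg_def in_keys_iff)

lemma sum_components:
  assumes "finite D" "mono_degree ` Poly_Mapping.keys p \<subseteq> D"
  shows "p = (\<Sum>d\<in>D. component d p)"
  by (rule poly_mapping_eqI) (use assms in \<open>auto simp: lookup_sum lookup_component image_subset_iff in_keys_iff\<close>)

section \<open>Quotients and linear algebra modulo an ideal\<close>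

lemma mem_carrier_0 [simp]: "0 \<in> carrier (mpoly_ring r)"
  and mem_carrier_1 [simp]: "1 \<in> carrier (mpoly_ring r)"
  by (simp_all add: mem_carrier_iff)

lemma mem_carrier_add [simp]:
  "p \<in> carrier (mpoly_ring r) \<Longrightarrow> q \<in> carrier (mpoly_ring r) \<Longrightarrow> p + q \<in> carrier (mpoly_ring r)"
  using Poly_Mapping.keys_add[of p q] by (auto simp: mem_carrier_iff)

lemma mem_carrier_mult [simp]:
  "p \<in> carrier (mpoly_ring r) \<Longrightarrow> q \<in> carrier (mpoly_ring r) \<Longrightarrow> p * q \<in> carrier (mpoly_ring r)"
  using keys_mult[of p q] by (force simp: mem_carrier_iff)

lemma mem_carrier_uminus [simp]:
  "p \<in> carrier (mpoly_ring r) \<Longrightarrow> - p \<in> carrier (mpoly_ring r)"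
  by (simp add: uminus_eq_const_mult)

lemma mem_carrier_diff [simp]:
  "p \<in> carrier (mpoly_ring r) \<Longrightarrow> q \<in> carrier (mpoly_ring r) \<Longrightarrow> p - q \<in> carrier (mpoly_ring r)"
  by (metis mem_carrier_add mem_carrier_uminus uminus_add_conv_diff add.commute)

lemma mem_carrier_sum:
  "(\<And>x. x \<in> X \<Longrightarrow> f x \<in> carrier (mpoly_ring r)) \<Longrightarrow> (\<Sum>x\<in>X. f x) \<in> carrier (mpoly_ring r)"
  by (induction X rule: infinite_finite_induct) auto

lemma mem_carrier_single [simp]:
  "m \<in> monoms r \<Longrightarrow> Poly_Mapping.single m k \<in> carrier (mpoly_ring r)"
  by (simp add: mem_carrier_iff)

lemma mem_carrier_form: "p \<in> forms r i \<Longrightarrow> p \<in> carrier (mpoly_ring r)"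
  using forms_subset_carrier by blast

lemma mem_carrier_var [simp]: "j < r \<Longrightarrow> var j \<in> carrier (mpoly_ring r)"
  by (rule mem_carrier_form[OF var_in_forms])

text \<open>Multiplication by an arbitrary polynomial reduces to multiplication by its terms, and
  additive inverses are products with the constant -1.\<close>

lemma ideal_mpolyI:
  fixes I :: "'k::field mpoly set"
  assumes "I \<subseteq> carrier (mpoly_ring r)" "0 \<in> I"
    and add: "\<And>p q. p \<in> I \<Longrightarrow> q \<in> I \<Longrightarrow> p + q \<in> I"
    and mult: "\<And>m k p. m \<in> monoms r \<Longrightarrow> p \<in> I \<Longrightarrow> Poly_Mapping.single m k * p \<in> I"
  shows "ideal I (mpoly_ring r)"
proof -
  interpret cring "mpoly_ring r :: 'k mpoly ring" by (rule mpoly_ring_cring)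
  have mult': "q * p \<in> I" if "q \<in> carrier (mpoly_ring r)" "p \<in> I" for p q
  proof -
    have "Poly_Mapping.keys q \<subseteq> monoms r" using that(1) by (simp add: mem_carrier_iff)
    then show ?thesis
      by (induction q rule: poly_mapping_induct_keys)
        (use that(2) assms in \<open>auto simp: distrib_right\<close>)
  qed
  have neg: "- p \<in> I" if "p \<in> I" for p
    unfolding uminus_eq_const_mult by (rule mult') (use that in simp_all)
  have minus: "\<ominus>\<^bsub>mpoly_ring r\<^esub> p = - p" if "p \<in> carrier (mpoly_ring r)" for p :: "'k mpoly"
    by (rule minus_equality) (use that in simp_all)
  show ?thesis
  proof (rule idealI)
    show "subgroup I (add_monoid (mpoly_ring r))"
    proof
      show "inv\<^bsub>add_monoid (mpoly_ring r)\<^esub> p \<in> I" if "p \<in> I" for p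
        using minus[of p] neg[OF that] assms(1) that by (auto simp: a_inv_def)
    qed (use assms in auto)
    show "a \<otimes>\<^bsub>mpoly_ring r\<^esub> x \<in> I" if "a \<in> I" "x \<in> carrier (mpoly_ring r)" for a x
      using mult'[OF that(2,1)] by (simp add: mult.commute)
  qed (use mult' ring_axioms in auto)
qed

section \<open>The quotient by a proper ideal as a vector space over the constants\<close>

locale proper_ideal =
  fixes r :: nat and I :: "'k::field mpoly set"
  assumes ideal: "ideal I (mpoly_ring r)" and one_notin: "1 \<notin> I"
begin

sublocale R: cring "mpoly_ring r :: 'k mpoly ring"
  by (rule mpoly_ring_cring)

sublocale I: ideal I "mpoly_ring r"
  by (rule ideal)

sublocale A: cring "alg r I"
  unfolding alg_def by (rule I.quotient_is_cring) (rule mpoly_ring_cring)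

lemma ideal_zero [simp]: "0 \<in> I"
  using I.zero_closed by simp

lemma ideal_add: "p \<in> I \<Longrightarrow> q \<in> I \<Longrightarrow> p + q \<in> I"
  using I.a_closed by simp

lemma ideal_mult: "p \<in> I \<Longrightarrow> q \<in> carrier (mpoly_ring r) \<Longrightarrow> q * p \<in> I"
  using I.I_l_closed by simp

lemma ideal_sum: "(\<And>x. x \<in> X \<Longrightarrow> f x \<in> I) \<Longrightarrow> (\<Sum>x\<in>X. f x) \<in> I"
  by (induction X rule: infinite_finite_induct) (auto intro: ideal_add)

lemma minus_mpoly:
  assumes "(p :: 'k mpoly) \<in> carrier (mpoly_ring r)"
  shows "\<ominus>\<^bsub>mpoly_ring r\<^esub> p = - p"
  by (rule R.minus_equality) (use assms in simp_all)

lemma proj_hom: "proj r I \<in> ring_hom (mpoly_ring r) (alg r I)"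
  using I.rcos_ring_hom unfolding proj_def[abs_def] alg_def by (simp add: eta_contract_eq)

lemma
  assumes "p \<in> carrier (mpoly_ring r)" "q \<in> carrier (mpoly_ring r)"
  shows proj_add: "proj r I p \<oplus>\<^bsub>alg r I\<^esub> proj r I q = proj r I (p + q)"
    and proj_mult: "proj r I p \<otimes>\<^bsub>alg r I\<^esub> proj r I q = proj r I (p * q)"
  using ring_hom_add[OF proj_hom assms] ring_hom_mult[OF proj_hom assms] by simp_all

lemma proj_one: "\<one>\<^bsub>alg r I\<^esub> = proj r I 1"
  using ring_hom_one[OF proj_hom] by simp

lemma proj_zero: "\<zero>\<^bsub>alg r I\<^esub> = proj r I 0"
  using ring_hom_zero[OF proj_hom R.ring_axioms A.ring_axioms] by simp

lemma carrier_alg: "carrier (alg r I) = proj r I ` carrier (mpoly_ring r)"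
  unfolding alg_def proj_def FactRing_def A_RCOSETS_def' by auto

lemma proj_in_carrier [simp]: "p \<in> carrier (mpoly_ring r) \<Longrightarrow> proj r I p \<in> carrier (alg r I)"
  by (simp add: carrier_alg)

lemma proj_eq_iff:
  assumes "p \<in> carrier (mpoly_ring r)" "q \<in> carrier (mpoly_ring r)"
  shows "proj r I p = proj r I q \<longleftrightarrow> p - q \<in> I"
  using R.quotient_eq_iff_same_a_r_cos[OF ideal assms] assms
  by (simp add: proj_def a_minus_def minus_mpoly)

lemma proj_eq_zero_iff:
  "p \<in> carrier (mpoly_ring r) \<Longrightarrow> proj r I p = \<zero>\<^bsub>alg r I\<^esub> \<longleftrightarrow> p \<in> I"
  using proj_eq_iff[of p 0] by (simp add: proj_zero)

lemma proj_const_in_scalars [simp]: "proj r I (const c) \<in> scalars r I"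
  by (simp add: scalars_def)

text \<open>Properness gives \<open>1\<close> a nonzero class, which keeps zero out of the units;
  the class of a nonzero constant is inverted by the class of its inverse. All dimensions below are
  taken over this subfield.\<close>

lemma subfield_scalars: "subfield (scalars r I) (alg r I)"
proof -
  have uminus: "\<ominus>\<^bsub>alg r I\<^esub> proj r I (const c) = proj r I (const (- c))" for c
    by (rule A.minus_equality) (simp_all add: proj_add proj_zero const_add[symmetric])
  have subring: "subring (scalars r I) (alg r I)"
  proof (rule A.subringI)
    show "\<one>\<^bsub>alg r I\<^esub> \<in> scalars r I"
      unfolding proj_one using proj_const_in_scalars[of 1] by simp
  qed (auto simp: scalars_def uminus proj_add proj_mult const_add[symmetric] const_mult[symmetric])
  show ?thesis
  proof (rule A.subfieldI[OF A.subcringI'[OF subring]])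
    have "x \<in> Units (alg r I\<lparr>carrier := scalars r I\<rparr>) \<longleftrightarrow> x \<in> scalars r I - {\<zero>\<^bsub>alg r I\<^esub>}" for x
    proof -
      have 1: "\<one>\<^bsub>alg r I\<^esub> \<noteq> \<zero>\<^bsub>alg r I\<^esub>"
        using one_notin by (simp add: proj_one proj_eq_zero_iff)
      show ?thesis
      proof
        assume "x \<in> Units (alg r I\<lparr>carrier := scalars r I\<rparr>)"
        then obtain y where "x \<in> scalars r I" "y \<in> scalars r I" "y \<otimes>\<^bsub>alg r I\<^esub> x = \<one>\<^bsub>alg r I\<^esub>"
          by (auto simp: Units_def)
        moreover from this have "y \<in> carrier (alg r I)"
          using subringE(1)[OF subring] by blast
        ultimately show "x \<in> scalars r I - {\<zero>\<^bsub>alg r I\<^esub>}"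
          using 1 A.r_null[of y] by (metis Diff_iff singletonD)
      next
        assume x: "x \<in> scalars r I - {\<zero>\<^bsub>alg r I\<^esub>}"
        then obtain c where c: "x = proj r I (const c)" by (auto simp: scalars_def)
        with x have "c \<noteq> 0" by (auto simp: proj_zero)
        then have "proj r I (const (inverse c)) \<otimes>\<^bsub>alg r I\<^esub> x = \<one>\<^bsub>alg r I\<^esub>"
          "x \<otimes>\<^bsub>alg r I\<^esub> proj r I (const (inverse c)) = \<one>\<^bsub>alg r I\<^esub>"
          by (simp_all add: c proj_mult const_mult[symmetric] proj_one)
        then show "x \<in> Units (alg r I\<lparr>carrier := scalars r I\<rparr>)"
          using x unfolding Units_def by (auto intro!: bexI[of _ "proj r I (const (inverse c))"])
      qed
    qed
    then show "Units (alg r I\<lparr>carrier := scalars r I\<rparr>) = scalars r I - {\<zero>\<^bsub>alg r I\<^esub>}"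
      by blast
  qed
qed

text \<open>Coefficients belong to positions of the list, not to polynomials, so a repeated entry
  counts as a dependency, as it does for the library's independent lists.\<close>

definition lincomb :: "(nat \<Rightarrow> 'k) \<Rightarrow> 'k mpoly list \<Rightarrow> 'k mpoly" where
  "lincomb k ps = (\<Sum>i<length ps. const (k i) * ps ! i)"

lemma lincomb_Nil [simp]: "lincomb k [] = 0"
  by (simp add: lincomb_def)

lemma lincomb_Cons: "lincomb k (p # ps) = const (k 0) * p + lincomb (\<lambda>i. k (Suc i)) ps"
  by (simp add: lincomb_def sum.lessThan_Suc_shift del: sum.lessThan_Suc)

lemma lincomb_in_carrier [simp]:
  "set ps \<subseteq> carrier (mpoly_ring r) \<Longrightarrow> lincomb k ps \<in> carrier (mpoly_ring r)"
  by (auto simp: lincomb_def subset_iff intro!: mem_carrier_sum)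

lemma const_mult_lincomb: "const c * lincomb k ps = lincomb (\<lambda>i. c * k i) ps"
  by (simp add: lincomb_def sum_distrib_left const_mult mult.assoc)

lemma lincomb_uminus: "lincomb (\<lambda>i. - k i) ps = - lincomb k ps"
  by (simp add: lincomb_def const_uminus sum_negf)

text \<open>The library builds a span one line at a time; the induction gathers the successive
  scalars into a single coefficient function.\<close>

lemma mem_Span_iff:
  assumes "set ps \<subseteq> carrier (mpoly_ring r)"
  shows "x \<in> A.Span (scalars r I) (map (proj r I) ps) \<longleftrightarrow> (\<exists>k. x = proj r I (lincomb k ps))"
  using assms
proof (induction ps arbitrary: x)
  case Nil
  then show ?case by (simp add: proj_zero)
next
  case (Cons p ps)
  then have p: "p \<in> carrier (mpoly_ring r)" and ps: "set ps \<subseteq> carrier (mpoly_ring r)" by auto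
  have "x \<in> A.Span (scalars r I) (map (proj r I) (p # ps)) \<longleftrightarrow>
    (\<exists>u\<in>scalars r I. \<exists>v\<in>A.Span (scalars r I) (map (proj r I) ps).
      x = u \<otimes>\<^bsub>alg r I\<^esub> proj r I p \<oplus>\<^bsub>alg r I\<^esub> v)"
    by (simp add: A.line_extension_mem_iff)
  also have "\<dots> \<longleftrightarrow> (\<exists>c k. x = proj r I (const c) \<otimes>\<^bsub>alg r I\<^esub> proj r I p \<oplus>\<^bsub>alg r I\<^esub> proj r I (lincomb k ps))"
    by (unfold Bex_def Cons.IH[OF ps], unfold scalars_def, blast)
  also have "\<dots> \<longleftrightarrow> (\<exists>c k. x = proj r I (const c * p + lincomb k ps))"
    using p ps by (simp add: proj_mult proj_add)
  also have "\<dots> \<longleftrightarrow> (\<exists>k. x = proj r I (lincomb k (p # ps)))"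
  proof (intro iffI; elim exE)
    fix c k assume "x = proj r I (const c * p + lincomb k ps)"
    then have "x = proj r I (lincomb (case_nat c k) (p # ps))"
      by (simp add: lincomb_Cons)
    then show "\<exists>k. x = proj r I (lincomb k (p # ps))" by blast
  qed (auto simp: lincomb_Cons)
  finally show ?case .
qed

text \<open>Linear independence of the residue classes, phrased with representatives so that later
  arguments compute with polynomials instead of cosets.\<close>

definition independent_mod :: "'k mpoly list \<Rightarrow> bool" where
  "independent_mod ps \<longleftrightarrow> (\<forall>k. lincomb k ps \<in> I \<longrightarrow> (\<forall>i<length ps. k i = 0))"

lemma independent_mod_Cons:
  assumes "set (p # ps) \<subseteq> carrier (mpoly_ring r)"
  shows "independent_mod (p # ps) \<longleftrightarrow>
     proj r I p \<notin> A.Span (scalars r I) (map (proj r I) ps) \<and> independent_mod ps"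
proof -
  have Span: "proj r I p \<in> A.Span (scalars r I) (map (proj r I) ps) \<longleftrightarrow> (\<exists>k. p - lincomb k ps \<in> I)"
    using assms by (subst mem_Span_iff) (auto simp: proj_eq_iff)
  show ?thesis
    unfolding Span
  proof (intro iffI conjI notI)
    assume ind: "independent_mod (p # ps)"
    show False if "\<exists>k. p - lincomb k ps \<in> I"
    proof -
      from that obtain k where "p - lincomb k ps \<in> I" ..
      moreover have "lincomb (case_nat 1 (\<lambda>i. - k i)) (p # ps) = p - lincomb k ps"
        by (simp add: lincomb_Cons lincomb_uminus)
      ultimately have "case_nat 1 (\<lambda>i. - k i) 0 = (0 :: 'k)"
        using ind unfolding independent_mod_def by (metis length_Cons zero_less_Suc)
      then show False by simp
    qed
    show "independent_mod ps"
      unfolding independent_mod_def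
    proof (intro allI impI)
      fix k i assume "lincomb k ps \<in> I" "i < length ps"
      then show "k i = 0"
        using ind[unfolded independent_mod_def, rule_format, of "case_nat 0 k" "Suc i"]
        by (simp add: lincomb_Cons)
    qed
  next
    assume *: "\<not> (\<exists>k. p - lincomb k ps \<in> I) \<and> independent_mod ps"
    show "independent_mod (p # ps)"
      unfolding independent_mod_def
    proof (intro allI impI)
      fix k i assume k: "lincomb k (p # ps) \<in> I" and i: "i < length (p # ps)"
      \<comment> \<open>A nonzero coefficient of \<open>p\<close> could be divided out, and this
        would place \<open>p\<close> in the span of \<open>ps\<close> modulo
        \<open>I\<close>.\<close>
      have k0: "k 0 = 0"
      proof (rule ccontr)
        assume "k 0 \<noteq> 0"
        then have "const (inverse (k 0)) * lincomb k (p # ps)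
            = p - lincomb (\<lambda>i. - (inverse (k 0) * k (Suc i))) ps"
          by (simp add: lincomb_uminus lincomb_Cons distrib_left mult.assoc[symmetric]
              const_mult[symmetric] const_mult_lincomb)
        moreover have "const (inverse (k 0)) * lincomb k (p # ps) \<in> I"
          using k by (simp add: ideal_mult)
        ultimately show False using * by auto
      qed
      with k have "lincomb (\<lambda>i. k (Suc i)) ps \<in> I" by (simp add: lincomb_Cons)
      then show "k i = 0"
        using * i k0 unfolding independent_mod_def by (cases i) auto
    qed
  qed
qed

lemma independent_map_proj_iff:
  assumes "set ps \<subseteq> carrier (mpoly_ring r)"
  shows "A.independent (scalars r I) (map (proj r I) ps) \<longleftrightarrow> independent_mod ps"
  using assms
proof (induction ps)
  case Nil
  then show ?case by (simp add: independent_mod_def)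
next
  case (Cons p ps)
  then have "A.independent (scalars r I) (map (proj r I) ps) \<longleftrightarrow> independent_mod ps"
    by simp
  moreover have "A.independent (scalars r I) (map (proj r I) (p # ps)) \<longleftrightarrow>
     proj r I p \<notin> A.Span (scalars r I) (map (proj r I) ps) \<and>
     A.independent (scalars r I) (map (proj r I) ps)"
    using Cons.prems by (auto intro: A.li_Cons dest: A.independent_backwards simp del: A.Span.simps)
  ultimately show ?case
    using independent_mod_Cons[OF Cons.prems] by simp
qed

definition basis_mod :: "'k mpoly list \<Rightarrow> 'k mpoly set \<Rightarrow> bool" where
  "basis_mod ps V \<longleftrightarrow> set ps \<subseteq> V \<and> independent_mod ps \<and> (\<forall>p\<in>V. \<exists>k. p - lincomb k ps \<in> I)"

definition subspace :: "'k mpoly set \<Rightarrow> bool" where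
  "subspace V \<longleftrightarrow> V \<subseteq> carrier (mpoly_ring r) \<and> 0 \<in> V \<and> (\<forall>p\<in>V. \<forall>q\<in>V. p + q \<in> V) \<and>
     (\<forall>c. \<forall>p\<in>V. const c * p \<in> V)"

lemma lincomb_in_subspace: "subspace V \<Longrightarrow> set ps \<subseteq> V \<Longrightarrow> lincomb k ps \<in> V"
  by (induction ps arbitrary: k) (auto simp: subspace_def lincomb_Cons)

lemma subspace_forms: "subspace (forms r i)"
  using forms_subset_carrier by (auto simp: subspace_def)

lemma subspace_carrier: "subspace (carrier (mpoly_ring r))"
  by (auto simp: subspace_def)

lemma Span_eq_proj_image_iff:
  assumes "subspace V" "set ps \<subseteq> V"
  shows "A.Span (scalars r I) (map (proj r I) ps) = proj r I ` V \<longleftrightarrow> (\<forall>p\<in>V. \<exists>k. p - lincomb k ps \<in> I)"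
proof -
  have V: "V \<subseteq> carrier (mpoly_ring r)" using assms(1) by (simp add: subspace_def)
  then have ps: "set ps \<subseteq> carrier (mpoly_ring r)" using assms(2) by blast
  have "A.Span (scalars r I) (map (proj r I) ps) \<subseteq> proj r I ` V"
    using mem_Span_iff[OF ps] lincomb_in_subspace[OF assms] by blast
  moreover have "proj r I p \<in> A.Span (scalars r I) (map (proj r I) ps) \<longleftrightarrow> (\<exists>k. p - lincomb k ps \<in> I)"
    if "p \<in> V" for p
    unfolding mem_Span_iff[OF ps] using that V ps by (simp add: proj_eq_iff subset_iff)
  ultimately show ?thesis
    unfolding set_eq_subset by (auto simp: image_subset_iff simp del: A.Span.simps)
qed

text \<open>The bridge from the library's dimension to polynomials: every member of a base of the
  image of \<open>V\<close> lies in that image and so lifts to a representative in \<open>V\<close>.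
  Hilbert functions and the dimension of the socle are both computed through it.\<close>

lemma dimension_proj_image_iff:
  assumes "subspace V"
  shows "A.dimension n (scalars r I) (proj r I ` V) \<longleftrightarrow> (\<exists>ps. length ps = n \<and> basis_mod ps V)"
proof -
  have V: "V \<subseteq> carrier (mpoly_ring r)" using assms by (simp add: subspace_def)
  show ?thesis
  proof
    assume "A.dimension n (scalars r I) (proj r I ` V)"
    from A.exists_base[OF subfield_scalars this] obtain Vs where
      Vs: "A.independent (scalars r I) Vs" "length Vs = n"
        "A.Span (scalars r I) Vs = proj r I ` V" "set Vs \<subseteq> carrier (alg r I)" by blast
    have "set Vs \<subseteq> proj r I ` V"
      using A.Span_base_incl[OF subfield_scalars Vs(4)] Vs(3) by blast
    then have "Vs \<in> map (proj r I) ` lists V"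
      by (simp add: lists_image[symmetric] in_lists_conv_set subset_iff)
    then obtain ps where ps: "Vs = map (proj r I) ps" "set ps \<subseteq> V"
      by (auto simp: in_lists_conv_set)
    have "basis_mod ps V"
      using Vs ps V Span_eq_proj_image_iff[OF assms ps(2)]
      by (auto simp: basis_mod_def independent_map_proj_iff)
    then show "\<exists>ps. length ps = n \<and> basis_mod ps V"
      using Vs(2) ps(1) by auto
  next
    assume "\<exists>ps. length ps = n \<and> basis_mod ps V"
    then obtain ps where ps: "length ps = n" "basis_mod ps V" by blast
    then have "set ps \<subseteq> V" by (simp add: basis_mod_def)
    with V have "set ps \<subseteq> carrier (mpoly_ring r)" by blast
    then have "A.independent (scalars r I) (map (proj r I) ps)"
      using ps by (simp add: independent_map_proj_iff basis_mod_def)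
    moreover have "A.Span (scalars r I) (map (proj r I) ps) = proj r I ` V"
      using ps Span_eq_proj_image_iff[OF assms \<open>set ps \<subseteq> V\<close>] by (simp add: basis_mod_def)
    ultimately show "A.dimension n (scalars r I) (proj r I ` V)"
      using A.dimensionI[OF subfield_scalars] ps(1) by fastforce
  qed
qed

lemma dim_eq_length_basis:
  assumes "subspace V" "basis_mod ps V"
  shows "A.dim (scalars r I) (proj r I ` V) = length ps"
  using A.dimI[OF subfield_scalars] dimension_proj_image_iff[OF assms(1)] assms(2)
  by (metis over_def)

lemma hilbert_function_eq_length_basis:
  "basis_mod ps (forms r i) \<Longrightarrow> hilbert_function r I i = length ps"
  unfolding hilbert_function_def graded_part_def by (rule dim_eq_length_basis[OF subspace_forms])

lemma lincomb_map_bij: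
  assumes "bij_betw f {..<n} B"
  shows "lincomb k (map (\<lambda>i. g (f i)) [0..<n]) = (\<Sum>b\<in>B. const (k (the_inv_into {..<n} f b)) * g b)"
proof -
  have "lincomb k (map (\<lambda>i. g (f i)) [0..<n]) = (\<Sum>i<n. const (k i) * g (f i))"
    by (simp add: lincomb_def)
  also have "\<dots> = (\<Sum>i<n. const (k (the_inv_into {..<n} f (f i))) * g (f i))"
    using assms by (simp add: the_inv_into_f_f bij_betw_def)
  also have "\<dots> = (\<Sum>b\<in>B. const (k (the_inv_into {..<n} f b)) * g b)"
    by (rule sum.reindex_bij_betw[OF assms])
  finally show ?thesis .
qed

text \<open>Bases arise naturally as families over a finite set, such as variables or labels; an
  enumeration of \<open>B\<close> turns them into the lists expected by
  \<open>basis_mod\<close>.\<close>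

lemma exists_basis_of_family:
  assumes "finite B" "g ` B \<subseteq> V"
    and ind: "\<And>k. (\<Sum>b\<in>B. const (k b) * g b) \<in> I \<Longrightarrow> \<forall>b\<in>B. k b = 0"
    and span: "\<And>p. p \<in> V \<Longrightarrow> \<exists>k. p - (\<Sum>b\<in>B. const (k b) * g b) \<in> I"
  obtains ps where "basis_mod ps V" "length ps = card B"
proof -
  obtain f where f: "bij_betw f {..<card B} B"
    using ex_bij_betw_nat_finite[OF assms(1)] by (auto simp: atLeast0LessThan)
  let ?n = "card B"
  let ?ps = "map (\<lambda>i. g (f i)) [0..<card B]"
  have inv: "the_inv_into {..<?n} f (f i) = i" if "i < ?n" for i
    using f that by (auto simp: the_inv_into_f_f bij_betw_def)
  have fB: "f i \<in> B" if "i < ?n" for i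
    using f that by (auto simp: bij_betw_def)
  have "basis_mod ?ps V"
    unfolding basis_mod_def
  proof (intro conjI ballI)
    show "set ?ps \<subseteq> V" using assms(2) fB by auto
    show "independent_mod ?ps"
      unfolding independent_mod_def lincomb_map_bij[OF f]
    proof (intro allI impI)
      fix k i assume "(\<Sum>b\<in>B. const (k (the_inv_into {..<?n} f b)) * g b) \<in> I" "i < length ?ps"
      then show "k i = 0"
        using ind[of "\<lambda>b. k (the_inv_into {..<?n} f b)"] fB[of i] inv[of i] by auto
    qed
  next
    fix p assume "p \<in> V"
    then obtain k where k: "p - (\<Sum>b\<in>B. const (k b) * g b) \<in> I" using span by blast
    have "(\<Sum>b\<in>B. const (k b) * g b) = lincomb (\<lambda>i. k (f i)) ?ps"
      unfolding lincomb_map_bij[OF f]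
      using f by (intro sum.cong) (auto simp: f_the_inv_into_f bij_betw_def)
    with k show "\<exists>k. p - lincomb k ?ps \<in> I" by auto
  qed
  then show thesis by (rule that) simp
qed

end

text \<open>Each element is the sum of its components, so an ideal closed under taking components is
  generated by the forms it contains.\<close>

lemma homogeneous_idealI:
  fixes I :: "'k::field mpoly set"
  assumes I: "ideal I (mpoly_ring r)" and comp: "\<And>p d. p \<in> I \<Longrightarrow> component d p \<in> I"
  shows "homogeneous_ideal r I"
proof -
  interpret R: cring "mpoly_ring r :: 'k mpoly ring" by (rule mpoly_ring_cring)
  interpret I: ideal I "mpoly_ring r" by (rule I)
  let ?F = "I \<inter> (\<Union>d. forms r d)"
  have F: "?F \<subseteq> carrier (mpoly_ring r)" using I.Icarr by blast
  interpret J: ideal "Idl\<^bsub>mpoly_ring r\<^esub> ?F" "mpoly_ring r" by (rule R.genideal_ideal[OF F])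
  have "I = Idl\<^bsub>mpoly_ring r\<^esub> ?F"
  proof
    show "Idl\<^bsub>mpoly_ring r\<^esub> ?F \<subseteq> I" by (rule R.genideal_minimal[OF I]) blast
    show "I \<subseteq> Idl\<^bsub>mpoly_ring r\<^esub> ?F"
    proof
      fix p assume p: "p \<in> I"
      have sum: "(\<Sum>d\<in>D. component d p) \<in> Idl\<^bsub>mpoly_ring r\<^esub> ?F" if "finite D" for D
        using that
      proof (induction D rule: finite_induct)
        case empty
        then show ?case using J.zero_closed by simp
      next
        case (insert d D)
        have "component d p \<in> ?F" using comp[OF p] component_in_forms[OF I.Icarr[OF p]] by blast
        then have "component d p \<in> Idl\<^bsub>mpoly_ring r\<^esub> ?F" using R.genideal_self[OF F] by blast
        then show ?case using insert J.a_closed by simp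
      qed
      show "p \<in> Idl\<^bsub>mpoly_ring r\<^esub> ?F"
        using sum[of "mono_degree ` Poly_Mapping.keys p"]
          sum_components[of "mono_degree ` Poly_Mapping.keys p" p] by simp
    qed
  qed
  then show ?thesis unfolding homogeneous_ideal_def by blast
qed

text \<open>The polynomials all of whose components lie in \<open>I\<close> form an ideal. It
  contains the homogeneous generators, hence all of \<open>I\<close>.\<close>

lemma homogeneous_idealD:
  fixes I :: "'k::field mpoly set"
  assumes "homogeneous_ideal r I"
  shows "ideal I (mpoly_ring r)" and "p \<in> I \<Longrightarrow> component d p \<in> I"
proof -
  interpret R: cring "mpoly_ring r :: 'k mpoly ring" by (rule mpoly_ring_cring)
  from assms obtain F where F: "F \<subseteq> (\<Union>d. forms r d)" and I_eq: "I = Idl\<^bsub>mpoly_ring r\<^esub> F"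
    by (auto simp: homogeneous_ideal_def)
  have F': "F \<subseteq> carrier (mpoly_ring r)" using F forms_subset_carrier by blast
  show I: "ideal I (mpoly_ring r)" unfolding I_eq by (rule R.genideal_ideal[OF F'])
  interpret I: ideal I "mpoly_ring r" by (rule I)
  let ?J = "{p \<in> carrier (mpoly_ring r). \<forall>d. component d p \<in> I}"
  have zero: "0 \<in> I" using I.zero_closed by simp
  have J: "ideal ?J (mpoly_ring r)"
  proof (rule ideal_mpolyI)
    fix m k p assume m: "m \<in> monoms r" and p: "p \<in> ?J"
    then show "Poly_Mapping.single m k * p \<in> ?J"
      using I.I_l_closed[of _ "Poly_Mapping.single m k"] zero by (auto simp: component_single_mult)
  next
    fix p q assume "p \<in> ?J" "q \<in> ?J"
    then show "p + q \<in> ?J"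
      using I.a_closed by (simp add: component_add)
  qed (use zero in auto)
  have "F \<subseteq> ?J"
  proof
    fix p assume p: "p \<in> F"
    then obtain i where "p \<in> forms r i" using F by blast
    moreover have "p \<in> I" unfolding I_eq using p R.genideal_self[OF F'] by blast
    ultimately show "p \<in> ?J" using zero by (auto simp: component_form mem_carrier_form)
  qed
  then have "I \<subseteq> ?J" using R.genideal_minimal[OF J] I_eq by simp
  then show "p \<in> I \<Longrightarrow> component d p \<in> I" by blast
qed

section \<open>The socle through polynomial representatives\<close>

definition annihilator_of_vars :: "nat \<Rightarrow> 'k::field mpoly set \<Rightarrow> 'k mpoly set" where
  "annihilator_of_vars r I = {p \<in> carrier (mpoly_ring r). \<forall>j<r. p * var j \<in> I}"

text \<open>The elements killed by a fixed \<open>a\<close> form an ideal, so \<open>a\<close>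
  annihilates the whole maximal ideal as soon as it annihilates the variables.\<close>

lemma (in proper_ideal) socle_eq: "socle r I = proj r I ` annihilator_of_vars r I"
proof
  have gen: "proj r I ` var ` {..<r} \<subseteq> carrier (alg r I)" by auto
  show "socle r I \<subseteq> proj r I ` annihilator_of_vars r I"
  proof
    fix a assume a: "a \<in> socle r I"
    then obtain p where p: "p \<in> carrier (mpoly_ring r)" "a = proj r I p"
      by (auto simp: socle_def carrier_alg)
    have "p * var j \<in> I" if "j < r" for j
    proof -
      have "proj r I (var j) \<in> max_ideal r I"
        using A.genideal_self[OF gen] that unfolding max_ideal_def by blast
      then have "proj r I (p * var j) = \<zero>\<^bsub>alg r I\<^esub>"
        using a p that unfolding socle_def by (auto simp flip: proj_mult)
      then show ?thesis using p that by (simp add: proj_eq_zero_iff)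
    qed
    then show "a \<in> proj r I ` annihilator_of_vars r I"
      using p by (auto simp: annihilator_of_vars_def)
  qed
  show "proj r I ` annihilator_of_vars r I \<subseteq> socle r I"
  proof
    fix a assume "a \<in> proj r I ` annihilator_of_vars r I"
    then obtain p where p: "a = proj r I p" "p \<in> carrier (mpoly_ring r)" "\<And>j. j < r \<Longrightarrow> p * var j \<in> I"
      by (auto simp: annihilator_of_vars_def)
    then have a: "a \<in> carrier (alg r I)" by simp
    let ?J = "{b \<in> carrier (alg r I). a \<otimes>\<^bsub>alg r I\<^esub> b = \<zero>\<^bsub>alg r I\<^esub>}"
    have "ideal ?J (alg r I)"
    proof (rule idealI[OF A.ring_axioms])
      show "subgroup ?J (add_monoid (alg r I))"
      proof
        show "inv\<^bsub>add_monoid (alg r I)\<^esub> x \<in> ?J" if "x \<in> ?J" for x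
          unfolding a_inv_def[symmetric] using that a A.r_minus[of a x] by simp
      qed (use a A.r_distr in auto)
    next
      show 1: "x \<otimes>\<^bsub>alg r I\<^esub> b \<in> ?J" if "b \<in> ?J" "x \<in> carrier (alg r I)" for b x
        using that a A.m_lcomm[of a x b] by simp
      show "b \<otimes>\<^bsub>alg r I\<^esub> x \<in> ?J" if "b \<in> ?J" "x \<in> carrier (alg r I)" for b x
        using 1[OF that] that A.m_comm[of b x] by simp
    qed
    moreover have "proj r I ` var ` {..<r} \<subseteq> ?J"
    proof
      fix b assume "b \<in> proj r I ` var ` {..<r}"
      then obtain j where "j < r" "b = proj r I (var j)" by blast
      then show "b \<in> ?J"
        using p proj_eq_zero_iff[of "p * var j"] by (simp add: proj_mult)
    qed
    ultimately have "max_ideal r I \<subseteq> ?J"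
      unfolding max_ideal_def by (rule A.genideal_minimal)
    then show "a \<in> socle r I" using a by (auto simp: socle_def)
  qed
qed


section \<open>Quotients by binomial and monomial relations\<close>

text \<open>When monomials with equal labels under \<open>c\<close> are identified, this is the
  coordinate of \<open>p\<close> at the label \<open>a\<close>.\<close>

definition class_sum :: "((nat \<Rightarrow>\<^sub>0 nat) \<Rightarrow> 'a) \<Rightarrow> 'a \<Rightarrow> 'k::field mpoly \<Rightarrow> 'k" where
  "class_sum c a p = (\<Sum>m\<in>Poly_Mapping.keys p. if c m = a then Poly_Mapping.lookup p m else 0)"

text \<open>As a vector space it is spanned by the monomials labelled \<open>z\<close> and the
  differences of monomials with equal labels. Describing it by vanishing coordinates makes
  membership a computation and hands over a dual basis.\<close>

definition class_ideal :: "nat \<Rightarrow> ((nat \<Rightarrow>\<^sub>0 nat) \<Rightarrow> 'a) \<Rightarrow> 'a \<Rightarrow> 'k::field mpoly set" where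
  "class_ideal r c z = {p \<in> carrier (mpoly_ring r). \<forall>a. a \<noteq> z \<longrightarrow> class_sum c a p = 0}"

lemma class_idealD: "p \<in> class_ideal r c z \<Longrightarrow> a \<noteq> z \<Longrightarrow> class_sum c a p = 0"
  by (simp add: class_ideal_def)

lemma single_in_class_ideal:
  "m \<in> monoms r \<Longrightarrow> c m = z \<Longrightarrow> Poly_Mapping.single m k \<in> class_ideal r c z"
  by (simp add: class_ideal_def class_sum_def)

lemma class_sum_zero [simp]: "class_sum c a 0 = 0"
  by (simp add: class_sum_def)

lemma class_sum_single [simp]:
  "class_sum c a (Poly_Mapping.single m k) = (if c m = a then k else 0)"
  by (simp add: class_sum_def)

lemma class_sum_add: "class_sum c a (p + q) = class_sum c a p + class_sum c a q"
  unfolding class_sum_def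
  by (rule setsum_keys_plus_distrib[where f = "\<lambda>m v. if c m = a then v else 0"]) auto

lemma class_sum_single_mult:
  "class_sum c a (Poly_Mapping.single m k * p) = k * class_sum (\<lambda>n. c (m + n)) a p"
  by (rule poly_mapping_induct_keys[of p UNIV])
    (simp_all add: mult_single class_sum_add distrib_left)

lemma class_sum_diff: "class_sum c a (p - q) = class_sum c a p - class_sum c a q"
  using class_sum_add[of c a "p - q" q] by simp

lemma class_sum_sum: "class_sum c a (\<Sum>x\<in>X. f x) = (\<Sum>x\<in>X. class_sum c a (f x))"
  by (induction X rule: infinite_finite_induct) (simp_all add: class_sum_add)

lemma class_sum_cong:
  "(\<And>m. m \<in> Poly_Mapping.keys p \<Longrightarrow> c m = a \<longleftrightarrow> c' m = a') \<Longrightarrow> class_sum c a p = class_sum c' a' p"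
  unfolding class_sum_def by (intro sum.cong) auto

lemma class_sum_eq_0:
  "(\<And>m. m \<in> Poly_Mapping.keys p \<Longrightarrow> c m \<noteq> a) \<Longrightarrow> class_sum c a p = 0"
  unfolding class_sum_def by (intro sum.neutral) auto

text \<open>Each condition on the labelling serves one property of \<open>class_ideal\<close>:
  \<open>cong\<close> and \<open>zero\<close> make it an ideal, \<open>degree\<close> makes it
  homogeneous, \<open>bound\<close> makes the quotient finite-dimensional, \<open>c_0\<close> makes
  it proper, and the two conditions on variables keep nonzero linear forms out.\<close>

locale monomial_classes =
  fixes r :: nat and c :: "(nat \<Rightarrow>\<^sub>0 nat) \<Rightarrow> 'a" and z :: 'a and e :: nat
  assumes cong: "m \<in> monoms r \<Longrightarrow> m' \<in> monoms r \<Longrightarrow> n \<in> monoms r \<Longrightarrow> c m = c m' \<Longrightarrow> c (m + n) = c (m' + n)"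
    and zero: "m \<in> monoms r \<Longrightarrow> n \<in> monoms r \<Longrightarrow> c m = z \<Longrightarrow> c (m + n) = z"
    and degree: "m \<in> monoms r \<Longrightarrow> m' \<in> monoms r \<Longrightarrow> c m = c m' \<Longrightarrow> c m \<noteq> z \<Longrightarrow> mono_degree m = mono_degree m'"
    and bound: "m \<in> monoms r \<Longrightarrow> e < mono_degree m \<Longrightarrow> c m = z"
    and c_0: "c 0 \<noteq> z"
    and c_var: "j < r \<Longrightarrow> c (Poly_Mapping.single j 1) \<noteq> z"
    and c_var_inj: "i < r \<Longrightarrow> j < r \<Longrightarrow> c (Poly_Mapping.single i 1) = c (Poly_Mapping.single j 1) \<Longrightarrow> i = j"
begin

lemma ideal_class_ideal: "ideal (class_ideal r c z :: 'k::field mpoly set) (mpoly_ring r)"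
proof (rule ideal_mpolyI)
  fix m and k :: 'k and p :: "'k mpoly" assume m: "m \<in> monoms r" and p: "p \<in> class_ideal r c z"
  have keys: "Poly_Mapping.keys p \<subseteq> monoms r"
    using p by (simp add: class_ideal_def mem_carrier_iff)
  have "class_sum (\<lambda>n. c (m + n)) a p = 0" if a: "a \<noteq> z" for a
  proof -
    let ?N = "{n \<in> Poly_Mapping.keys p. c (m + n) = a}"
    have "class_sum (\<lambda>n. c (m + n)) a p = (\<Sum>n\<in>?N. Poly_Mapping.lookup p n)"
      by (simp add: class_sum_def sum.inter_filter)
    also have "\<dots> = (\<Sum>b\<in>c ` ?N. \<Sum>n | n \<in> ?N \<and> c n = b. Poly_Mapping.lookup p n)"
      by (rule sum.image_gen) simp
    also have "\<dots> = (\<Sum>b\<in>c ` ?N. class_sum c b p)"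
    proof (rule sum.cong[OF refl])
      fix b assume "b \<in> c ` ?N"
      then obtain n where n: "n \<in> ?N" "b = c n" by blast
      \<comment> \<open>By congruence, one monomial of label \<open>b\<close> in \<open>?N\<close>
        brings all monomials of \<open>p\<close> with that label along. The inner sum is therefore a
        full \<open>class_sum\<close>, which vanishes.\<close>
      have "c (m + n') = a" if "n' \<in> Poly_Mapping.keys p" "c n' = b" for n'
        using cong[of n' n m] that n m keys by (auto simp: add.commute)
      then have "{n' \<in> ?N. c n' = b} = {n' \<in> Poly_Mapping.keys p. c n' = b}" by auto
      then show "(\<Sum>n | n \<in> ?N \<and> c n = b. Poly_Mapping.lookup p n) = class_sum c b p"
        by (simp add: class_sum_def sum.inter_filter)
    qed
    also have "\<dots> = 0"
    proof (intro sum.neutral ballI)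
      fix b assume "b \<in> c ` ?N"
      then obtain n where n: "n \<in> ?N" "b = c n" by blast
      then have "b \<noteq> z" using zero[of n m] a m keys by (auto simp: add.commute)
      then show "class_sum c b p = 0" using p by (simp add: class_ideal_def)
    qed
    finally show ?thesis .
  qed
  then show "Poly_Mapping.single m k * p \<in> class_ideal r c z"
    using p m by (simp add: class_ideal_def class_sum_single_mult)
qed (auto simp: class_ideal_def class_sum_add)

lemma proper_class_ideal: "proper_ideal r (class_ideal r c z :: 'k::field mpoly set)"
proof (rule proper_ideal.intro)
  have "class_sum c (c 0) (1 :: 'k mpoly) = 1"
    unfolding single_one[symmetric] class_sum_single by simp
  then show "(1 :: 'k mpoly) \<notin> class_ideal r c z"
    using c_0 by (auto simp: class_ideal_def)
qed (rule ideal_class_ideal)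

text \<open>Equal labels other than \<open>z\<close> force equal degrees, so passing to a component
  either keeps a class whole or removes it entirely.\<close>

lemma component_in_class_ideal:
  assumes p: "p \<in> class_ideal r c z"
  shows "component d p \<in> class_ideal r c z"
proof -
  have carr: "p \<in> carrier (mpoly_ring r)" using p by (simp add: class_ideal_def)
  have "class_sum c a (component d p) = 0" if a: "a \<noteq> z" for a
  proof (cases "\<exists>m \<in> Poly_Mapping.keys p. c m = a \<and> mono_degree m = d")
    case True
    then obtain m where m: "m \<in> Poly_Mapping.keys p" "c m = a" "mono_degree m = d" by blast
    have d: "mono_degree n = d" if "n \<in> Poly_Mapping.keys p" "c n = a" for n
      using degree[of n m] that m a carr by (auto simp: mem_carrier_iff)
    have "class_sum c a (component d p) =
        (\<Sum>n\<in>Poly_Mapping.keys p. if c n = a then Poly_Mapping.lookup (component d p) n else 0)"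
      unfolding class_sum_def
      by (rule sum.mono_neutral_left) (auto simp: in_keys_iff lookup_component split: if_splits)
    also have "\<dots> = class_sum c a p"
      unfolding class_sum_def by (rule sum.cong) (auto simp: lookup_component d)
    finally show ?thesis using p a by (simp add: class_ideal_def)
  next
    case False
    then show ?thesis
      by (intro class_sum_eq_0) (auto simp: in_keys_iff lookup_component split: if_splits)
  qed
  then show ?thesis
    using component_in_forms[OF carr, of d] by (simp add: class_ideal_def mem_carrier_form)
qed

text \<open>One monomial is chosen for each label other than \<open>z\<close>. The functionals
  \<open>class_sum\<close> are dual to this choice: they prove independence and also supply the
  coefficients of an expansion.\<close>

lemma basis_of_classes:
  assumes X: "X \<subseteq> monoms r" and fin: "finite (c ` X - {z})"
  obtains ps :: "'k::field mpoly list"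
  where "proper_ideal.basis_mod (class_ideal r c z) ps {p. Poly_Mapping.keys p \<subseteq> X}"
    "length ps = card (c ` X - {z})"
proof -
  let ?I = "class_ideal r c z :: 'k mpoly set"
  interpret proper_ideal r ?I by (rule proper_class_ideal)
  define m where "m b = (SOME m. m \<in> X \<and> c m = b)" for b
  have m: "m b \<in> X" "c (m b) = b" if "b \<in> c ` X - {z}" for b
  proof -
    from that have "\<exists>m. m \<in> X \<and> c m = b" by blast
    from someI_ex[OF this] show "m b \<in> X" "c (m b) = b" by (simp_all add: m_def)
  qed
  let ?g = "\<lambda>b. Poly_Mapping.single (m b) (1 :: 'k)"
  have sum: "class_sum c a (\<Sum>b\<in>c ` X - {z}. const (k b) * ?g b) = (if a \<in> c ` X - {z} then k a else 0)"
    for a k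
  proof -
    have "class_sum c a (\<Sum>b\<in>c ` X - {z}. const (k b) * ?g b) = (\<Sum>b\<in>c ` X - {z}. if b = a then k b else 0)"
      unfolding class_sum_sum using m by (intro sum.cong) (auto simp: const_mult_single)
    then show ?thesis using fin by simp
  qed
  have carr: "(\<Sum>b\<in>c ` X - {z}. const (k b) * ?g b) \<in> carrier (mpoly_ring r)" for k
    by (intro mem_carrier_sum mem_carrier_mult mem_carrier_single) (use m X in auto)
  show thesis
  proof (rule exists_basis_of_family[of "c ` X - {z}" ?g "{p. Poly_Mapping.keys p \<subseteq> X}"])
    show "\<forall>b\<in>c ` X - {z}. k b = 0" if "(\<Sum>b\<in>c ` X - {z}. const (k b) * ?g b) \<in> ?I" for k
    proof
      fix b assume b: "b \<in> c ` X - {z}"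
      then show "k b = 0" using class_idealD[OF that, of b] sum[of b k] by (metis Diff_iff singletonI)
    qed
  next
    fix p :: "'k mpoly" assume p: "p \<in> {p. Poly_Mapping.keys p \<subseteq> X}"
    then have p_carr: "p \<in> carrier (mpoly_ring r)" using X by (auto simp: mem_carrier_iff)
    have other: "class_sum c a p = 0" if "a \<noteq> z" "a \<notin> c ` X" for a
      by (rule class_sum_eq_0) (use p that in auto)
    have "class_sum c a (p - (\<Sum>b\<in>c ` X - {z}. const (class_sum c b p) * ?g b)) = 0" if "a \<noteq> z" for a
      unfolding class_sum_diff sum[of a "\<lambda>b. class_sum c b p"] using other[OF that] that by auto
    then have "p - (\<Sum>b\<in>c ` X - {z}. const (class_sum c b p) * ?g b) \<in> ?I"
      using mem_carrier_diff[OF p_carr carr[of "\<lambda>b. class_sum c b p"]] by (simp only: class_ideal_def mem_Collect_eq) simp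
    then show "\<exists>k. p - (\<Sum>b\<in>c ` X - {z}. const (k b) * ?g b) \<in> ?I"
      by (rule exI[where P = "\<lambda>k. p - (\<Sum>b\<in>c ` X - {z}. const (k b) * ?g b) \<in> ?I"])
  qed (use fin m that in auto)
qed

lemma hilbert_function_class_ideal:
  "hilbert_function r (class_ideal r c z :: 'k::field mpoly set) i = card (c ` monoms_deg r i - {z})"
proof -
  interpret proper_ideal r "class_ideal r c z :: 'k mpoly set" by (rule proper_class_ideal)
  obtain ps where ps: "basis_mod ps {p. Poly_Mapping.keys p \<subseteq> monoms_deg r i}"
    "length ps = card (c ` monoms_deg r i - {z})"
    using basis_of_classes[of "monoms_deg r i"] by (auto simp: monoms_deg_subset)
  have "{p. Poly_Mapping.keys p \<subseteq> monoms_deg r i} = forms r i" by (auto simp: mem_forms_iff)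
  then show ?thesis using hilbert_function_eq_length_basis[of ps i] ps by metis
qed

lemma standard_graded_artinian_class_ideal:
  "standard_graded_artinian r (class_ideal r c z :: 'k::field mpoly set)"
proof -
  let ?I = "class_ideal r c z :: 'k mpoly set"
  interpret proper_ideal r ?I by (rule proper_class_ideal)
  have "homogeneous_ideal r ?I"
    by (rule homogeneous_idealI[OF ideal_class_ideal component_in_class_ideal])
  moreover have "?I \<noteq> carrier (mpoly_ring r)"
    using one_notin by (metis mem_carrier_1)
  moreover have "A.finite_dimension (scalars r ?I) (carrier (alg r ?I))"
  proof -
    \<comment> \<open>Labels other than \<open>z\<close> occur only up to degree \<open>e\<close>,
      where there are finitely many monomials.\<close>
    have "c ` monoms r - {z} \<subseteq> c ` (\<Union>i\<le>e. monoms_deg r i)"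
      using bound by (fastforce simp: monoms_deg_def not_less)
    then have fin: "finite (c ` monoms r - {z})" by (rule finite_subset) simp
    obtain ps where "basis_mod ps {p. Poly_Mapping.keys p \<subseteq> monoms r}"
      by (rule basis_of_classes[OF subset_refl fin])
    then have "basis_mod ps (carrier (mpoly_ring r))"
      by (simp add: mem_carrier_iff[symmetric])
    then show ?thesis
      unfolding carrier_alg using dimension_proj_image_iff[OF subspace_carrier] A.finite_dimensionI by blast
  qed
  moreover have "?I \<inter> forms r 1 = {0}"
  proof -
    have "p = 0" if p: "p \<in> ?I" "p \<in> forms r 1" for p
    proof (rule poly_mapping_eqI)
      fix m
      show "Poly_Mapping.lookup p m = Poly_Mapping.lookup 0 m"
      proof (cases "m \<in> Poly_Mapping.keys p")
        case True
        have vars: "\<exists>j<r. n = Poly_Mapping.single j 1" if "n \<in> Poly_Mapping.keys p" for n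
          using p(2) that unfolding mem_forms_iff monoms_deg_1 by blast
        from vars[OF True] obtain j where j: "j < r" "m = Poly_Mapping.single j 1" by blast
        \<comment> \<open>Distinct variables have distinct labels, so on a linear form a class sum
          is a single coefficient.\<close>
        have "class_sum c (c m) p = (\<Sum>n\<in>Poly_Mapping.keys p. if n = m then Poly_Mapping.lookup p n else 0)"
          unfolding class_sum_def
        proof (rule sum.cong[OF refl])
          fix n assume "n \<in> Poly_Mapping.keys p"
          with vars obtain i where "i < r" "n = Poly_Mapping.single i 1" by blast
          then show "(if c n = c m then Poly_Mapping.lookup p n else 0) = (if n = m then Poly_Mapping.lookup p n else 0)"
            using j c_var_inj[of i j] by auto
        qed
        also have "\<dots> = Poly_Mapping.lookup p m" using True by simp
        finally show ?thesis using class_idealD[OF p(1), of "c m"] c_var[OF j(1)] j(2) by simp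
      qed (simp add: in_keys_iff)
    qed
    then show ?thesis by auto
  qed
  ultimately show ?thesis by (simp add: standard_graded_artinian_def)
qed

lemma socle_degree_class_ideal:
  assumes "m \<in> monoms_deg r e" "c m \<noteq> z"
  shows "socle_degree r (class_ideal r c z :: 'k::field mpoly set) = e"
  unfolding socle_degree_def hilbert_function_class_ideal
proof (rule Greatest_equality)
  have "finite (c ` monoms_deg r e - {z})" "c ` monoms_deg r e - {z} \<noteq> {}" using assms by auto
  then show "0 < card (c ` monoms_deg r e - {z})" by (simp add: card_gt_0_iff)
next
  fix i assume "0 < card (c ` monoms_deg r i - {z})"
  then obtain n where "n \<in> monoms_deg r i" "c n \<noteq> z" by (auto simp: card_gt_0_iff)
  then show "i \<le> e" using bound[of n] by (auto simp: monoms_deg_def not_less[symmetric])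
qed

lemma h_vector_class_ideal:
  assumes "m \<in> monoms_deg r e" "c m \<noteq> z"
  shows "h_vector r (class_ideal r c z :: 'k::field mpoly set) =
    map (\<lambda>i. card (c ` monoms_deg r i - {z})) [0..<Suc e]"
  unfolding h_vector_def socle_degree_class_ideal[OF assms] by (simp add: hilbert_function_class_ideal)

text \<open>The monomial \<open>d\<close> supplied by \<open>dual\<close> carries exactly the class
  of \<open>m\<close> to the top class. Multiplication by \<open>d\<close> kills a socle element and
  transports its coordinate at \<open>c m\<close> to the top, so that coordinate is zero. Only the
  coordinate at \<open>c t\<close> can survive, and the socle is a line.\<close>

lemma gorenstein_class_ideal:
  assumes t: "t \<in> monoms_deg r e" "c t \<noteq> z"
    and dual: "\<And>m. m \<in> monoms r \<Longrightarrow> c m \<noteq> z \<Longrightarrow> c m \<noteq> c t \<Longrightarrow>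
      \<exists>d\<in>monoms r. d \<noteq> 0 \<and> (\<forall>n\<in>monoms r. c (d + n) = c t \<longleftrightarrow> c n = c m)"
  shows "gorenstein r (class_ideal r c z :: 'k::field mpoly set)"
proof -
  let ?I = "class_ideal r c z :: 'k mpoly set"
  interpret proper_ideal r ?I by (rule proper_class_ideal)
  let ?V = "annihilator_of_vars r ?I"
  let ?t = "Poly_Mapping.single t (1 :: 'k)"
  have t_mon: "t \<in> monoms r" "mono_degree t = e" using t by (auto simp: monoms_deg_def)
  have V: "subspace ?V"
    unfolding subspace_def annihilator_of_vars_def
    by (auto simp: distrib_right mult.assoc intro: ideal_add ideal_mult)
  have t_V: "?t \<in> ?V"
  proof -
    have "c (t + Poly_Mapping.single j 1) = z" if "j < r" for j
      by (rule bound) (use that t_mon in \<open>auto simp: mono_degree_add\<close>)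
    then have "?t * var j \<in> ?I" if "j < r" for j
      unfolding var_def mult_single using that t_mon by (intro single_in_class_ideal) auto
    then show ?thesis using t_mon by (simp add: annihilator_of_vars_def)
  qed
  have span: "p - const (class_sum c (c t) p) * ?t \<in> ?I" if p: "p \<in> ?V" for p
  proof -
    have carr: "p \<in> carrier (mpoly_ring r)" using p by (simp add: annihilator_of_vars_def)
    have "class_sum c a p = 0" if a: "a \<noteq> z" "a \<noteq> c t" for a
    proof (rule ccontr)
      assume nz: "class_sum c a p \<noteq> 0"
      then obtain m where m: "m \<in> Poly_Mapping.keys p" "c m = a"
        using class_sum_eq_0[of p c a] by blast
      then have "m \<in> monoms r" using carr by (auto simp: mem_carrier_iff)
      with dual[of m] m a obtain d where d: "d \<in> monoms r" "d \<noteq> 0"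
        "\<And>n. n \<in> monoms r \<Longrightarrow> c (d + n) = c t \<longleftrightarrow> c n = a" by auto
      \<comment> \<open>Since \<open>d\<close> is not constant, it is a multiple of a variable, and
        \<open>p\<close> times that variable lies in the ideal.\<close>
      from d(2) obtain j where j: "j \<in> Poly_Mapping.keys d"
        by (metis keys_eq_empty ex_in_conv)
      then obtain d' where d': "d = Poly_Mapping.single j 1 + d'" by (rule mono_split_var)
      have "j < r" using j d(1) by (auto simp: monoms_def)
      then have "p * var j \<in> ?I" using p by (simp add: annihilator_of_vars_def)
      then have "Poly_Mapping.single d' 1 * (p * var j) \<in> ?I"
        by (rule ideal_mult) (use d(1) d' in simp)
      moreover have "Poly_Mapping.single d 1 = Poly_Mapping.single d' 1 * (var j :: 'k mpoly)"
        by (simp add: d' var_def mult_single add.commute)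
      ultimately have "Poly_Mapping.single d 1 * p \<in> ?I"
        by (simp only: mult_ac)
      then have "class_sum c (c t) (Poly_Mapping.single d 1 * p) = 0"
        by (rule class_idealD) (rule t(2))
      \<comment> \<open>By the choice of \<open>d\<close>, the shifted labelling takes the value
        \<open>c t\<close> exactly where \<open>c\<close> takes the value \<open>a\<close>.\<close>
      moreover have "class_sum c (c t) (Poly_Mapping.single d 1 * p) = class_sum c a p"
        unfolding class_sum_single_mult mult_1
        by (rule class_sum_cong) (use d(3) carr in \<open>auto simp: mem_carrier_iff\<close>)
      ultimately show False using nz by simp
    qed
    then have "class_sum c a (p - const (class_sum c (c t) p) * ?t) = 0" if "a \<noteq> z" for a
      using that by (cases "a = c t") (auto simp: class_sum_diff const_mult_single)
    moreover have "p - const (class_sum c (c t) p) * ?t \<in> carrier (mpoly_ring r)"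
      by (intro mem_carrier_diff mem_carrier_mult const_in_carrier mem_carrier_single carr t_mon)
    ultimately show ?thesis by (simp only: class_ideal_def mem_Collect_eq) simp
  qed
  have lincomb1: "lincomb k [?t] = const (k 0) * ?t" for k
    by (simp add: lincomb_def)
  have "basis_mod [?t] ?V"
    unfolding basis_mod_def independent_mod_def lincomb1
  proof (intro conjI ballI allI impI)
    fix k :: "nat \<Rightarrow> 'k" and i assume k: "const (k 0) * ?t \<in> ?I" and i: "i < length [?t]"
    have "class_sum c (c t) (const (k 0) * ?t) = k 0" by (simp add: const_mult_single)
    then have "k 0 = 0" using class_idealD[OF k t(2)] by simp
    then show "k i = 0" using i by simp
  next
    fix p assume "p \<in> ?V"
    from span[OF this] show "\<exists>k. p - const (k 0) * ?t \<in> ?I" by (intro exI[of _ "\<lambda>_. _"])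
  qed (use t_V in auto)
  then have "A.dimension 1 (scalars r ?I) (socle r ?I)"
    unfolding socle_eq dimension_proj_image_iff[OF V] by (intro exI[of _ "[?t]"]) simp
  moreover have "socle r ?I \<subseteq> graded_part r ?I e"
  proof
    fix a assume "a \<in> socle r ?I"
    then obtain p where p: "p \<in> ?V" "a = proj r ?I p" by (auto simp: socle_eq)
    have form: "const (class_sum c (c t) p) * ?t \<in> forms r e" using t by simp
    have "p \<in> carrier (mpoly_ring r)" using p by (simp add: annihilator_of_vars_def)
    then have "a = proj r ?I (const (class_sum c (c t) p) * ?t)"
      using span[OF p(1)] mem_carrier_form[OF form] p(2) by (simp add: proj_eq_iff)
    then show "a \<in> graded_part r ?I e" using form by (auto simp: graded_part_def)
  qed
  ultimately show ?thesis
    using t by (simp add: gorenstein_def level_def socle_degree_class_ideal)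
qed

end

section \<open>Symmetry of Gorenstein $h$-vectors\<close>

text \<open>Gaussian elimination: a homogeneous linear system with fewer equations than unknowns has
  a nontrivial solution. A pivot removes one equation and one unknown.\<close>

lemma exists_nontrivial_relation:
  fixes M :: "'a \<Rightarrow> 'b \<Rightarrow> 'k::field"
  assumes "finite B" "finite A" "card B < card A"
  obtains c where "\<exists>a\<in>A. c a \<noteq> 0" "\<And>b. b \<in> B \<Longrightarrow> (\<Sum>a\<in>A. c a * M a b) = 0"
proof -
  have "\<exists>c. (\<exists>a\<in>A. c a \<noteq> 0) \<and> (\<forall>b\<in>B. (\<Sum>a\<in>A. c a * M a b) = 0)"
    using assms
  proof (induction B arbitrary: A M rule: finite_induct)
    case empty
    then have "A \<noteq> {}" by auto
    then show ?case by (intro exI[of _ "\<lambda>_. 1"]) auto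
  next
    case (insert b B)
    show ?case
    proof (cases "\<forall>a\<in>A. M a b = 0")
      case True
      have "card B < card A" using insert by simp
      from insert.IH[OF insert.prems(1) this, of M] obtain c where
        "\<exists>a\<in>A. c a \<noteq> 0" "\<forall>b\<in>B. (\<Sum>a\<in>A. c a * M a b) = 0" by blast
      with True show ?thesis by (intro exI[of _ c]) simp
    next
      case False
      then obtain a0 where a0: "a0 \<in> A" "M a0 b \<noteq> 0" by blast
      let ?A = "A - {a0}"
      have "card B < card ?A" using insert a0 by simp
      from insert.IH[OF _ this, of "\<lambda>a b'. M a b' - M a b / M a0 b * M a0 b'"] insert.prems
      obtain c where c: "\<exists>a\<in>?A. c a \<noteq> 0"
        "\<And>b'. b' \<in> B \<Longrightarrow> (\<Sum>a\<in>?A. c a * (M a b' - M a b / M a0 b * M a0 b')) = 0"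
        by auto
      \<comment> \<open>With \<open>- s\<close> as the coefficient at the pivot \<open>a0\<close>,
        the equation for \<open>b\<close> holds; the other equations are then those of the
        eliminated system.\<close>
      define s where "s = (\<Sum>a\<in>?A. c a * M a b) / M a0 b"
      let ?c = "c(a0 := - s)"
      have split: "(\<Sum>a\<in>A. ?c a * M a b') = (\<Sum>a\<in>?A. c a * M a b') - s * M a0 b'" for b'
      proof -
        have "(\<Sum>a\<in>A. ?c a * M a b') = ?c a0 * M a0 b' + (\<Sum>a\<in>?A. ?c a * M a b')"
          by (rule sum.remove) (use insert.prems a0 in auto)
        also have "(\<Sum>a\<in>?A. ?c a * M a b') = (\<Sum>a\<in>?A. c a * M a b')"
          by (rule sum.cong) auto
        finally show ?thesis by simp
      qed
      have "(\<Sum>a\<in>A. ?c a * M a b') = 0" if "b' \<in> insert b B" for b'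
      proof (cases "b' = b")
        case True
        then show ?thesis unfolding split using a0 by (simp add: s_def)
      next
        case False
        then have "(\<Sum>a\<in>?A. c a * M a b') - (\<Sum>a\<in>?A. c a * M a b / M a0 b * M a0 b') = 0"
          using that c(2)[of b'] by (simp add: right_diff_distrib sum_subtractf mult.assoc)
        then show ?thesis unfolding split by (simp add: s_def sum_distrib_right sum_divide_distrib)
      qed
      moreover have "\<exists>a\<in>A. ?c a \<noteq> 0" using c(1) by auto
      ultimately show ?thesis by blast
    qed
  qed
  then show thesis using that by blast
qed

section \<open>Hilbert functions: bounds, vanishing and duality\<close>

context proper_ideal
begin


lemma lookup_lincomb:
  "Poly_Mapping.lookup (lincomb k ps) m = (\<Sum>i<length ps. k i * Poly_Mapping.lookup (ps ! i) m)"
  by (simp add: lincomb_def lookup_sum lookup_const_mult)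

text \<open>A longer list of forms would satisfy a linear relation coefficient by coefficient, and a
  relation that gives zero is in particular a relation modulo \<open>I\<close>.\<close>

lemma length_basis_forms_le:
  assumes "basis_mod ps (forms r i)"
  shows "length ps \<le> card (monoms_deg r i)"
proof (rule ccontr)
  assume "\<not> ?thesis"
  then obtain k where k: "\<exists>a\<in>{..<length ps}. k a \<noteq> 0"
    "\<And>m. m \<in> monoms_deg r i \<Longrightarrow> (\<Sum>a<length ps. k a * Poly_Mapping.lookup (ps ! a) m) = 0"
    using exists_nontrivial_relation[of "monoms_deg r i" "{..<length ps}" "\<lambda>a. Poly_Mapping.lookup (ps ! a)"]
    by auto
  have ps: "set ps \<subseteq> forms r i" using assms by (simp add: basis_mod_def)
  have "lincomb k ps = 0"
  proof (rule poly_mapping_eqI)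
    fix m
    show "Poly_Mapping.lookup (lincomb k ps) m = Poly_Mapping.lookup 0 m"
    proof (cases "m \<in> monoms_deg r i")
      case False
      then have "Poly_Mapping.lookup (ps ! a) m = 0" if "a < length ps" for a
        using ps nth_mem[OF that] by (auto simp: mem_forms_iff in_keys_iff subset_iff)
      then show ?thesis by (simp add: lookup_lincomb)
    qed (simp add: lookup_lincomb k(2))
  qed
  then show False using k(1) assms by (auto simp: basis_mod_def independent_mod_def)
qed

text \<open>The monomials of degree \<open>i\<close> span the graded part, which is therefore
  finite-dimensional; this lets \<open>dim\<close> be read as the length of an actual basis.\<close>

lemma exists_basis_forms: obtains ps where "basis_mod ps (forms r i)"
proof -
  obtain ms where ms: "set ms = monoms_deg r i" "distinct ms"
    using finite_distinct_list[OF finite_monoms_deg] by blast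
  let ?ps = "map (\<lambda>m. Poly_Mapping.single m (1::'k)) ms"
  have ps: "set ?ps \<subseteq> forms r i" using ms by auto
  have "p = lincomb (\<lambda>a. Poly_Mapping.lookup p (ms ! a)) ?ps" if "p \<in> forms r i" for p
  proof (rule poly_mapping_eqI)
    fix m
    have "Poly_Mapping.lookup (lincomb (\<lambda>a. Poly_Mapping.lookup p (ms ! a)) ?ps) m
        = (\<Sum>a<length ms. if ms ! a = m then Poly_Mapping.lookup p m else 0)"
      by (auto simp: lookup_lincomb lookup_single when_def intro!: sum.cong)
    also have "\<dots> = (\<Sum>m'\<in>set ms. if m' = m then Poly_Mapping.lookup p m else 0)"
      using sum.reindex_bij_betw[OF bij_betw_nth[OF ms(2) refl refl],
          of "\<lambda>m'. if m' = m then Poly_Mapping.lookup p m else 0"] by simp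
    also have "\<dots> = Poly_Mapping.lookup p m"
      using that ms(1) by (auto simp: mem_forms_iff in_keys_iff subset_iff)
    finally show "Poly_Mapping.lookup p m
        = Poly_Mapping.lookup (lincomb (\<lambda>a. Poly_Mapping.lookup p (ms ! a)) ?ps) m" ..
  qed
  then have "\<forall>p\<in>forms r i. \<exists>k. p - lincomb k ?ps \<in> I"
    by (metis diff_self ideal_zero)
  then have "A.Span (scalars r I) (map (proj r I) ?ps) = proj r I ` forms r i"
    using Span_eq_proj_image_iff[OF subspace_forms ps] by blast
  moreover have "set (map (proj r I) ?ps) \<subseteq> carrier (alg r I)"
    using ps mem_carrier_form by force
  ultimately have "A.finite_dimension (scalars r I) (proj r I ` forms r i)"
    using A.Span_finite_dimension[OF subfield_scalars] by metis
  then show thesis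
    using that dimension_proj_image_iff[OF subspace_forms] by (auto simp: A.finite_dimension_def)
qed

lemma hilbert_function_le_card_monoms: "hilbert_function r I i \<le> card (monoms_deg r i)"
  using exists_basis_forms[of i] hilbert_function_eq_length_basis length_basis_forms_le by metis

lemma forms_subset_ideal_if_hilbert_function_0:
  assumes "hilbert_function r I i = 0"
  shows "forms r i \<subseteq> I"
proof -
  obtain ps where ps: "basis_mod ps (forms r i)" by (rule exists_basis_forms)
  then have "ps = []" using hilbert_function_eq_length_basis[OF ps] assms by simp
  then show ?thesis using ps by (auto simp: basis_mod_def)
qed

lemma hilbert_function_0_if_forms_subset_ideal:
  assumes "forms r i \<subseteq> I"
  shows "hilbert_function r I i = 0"
  using assms by (subst hilbert_function_eq_length_basis[of "[]"])
    (auto simp: basis_mod_def independent_mod_def)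

text \<open>Every monomial of degree \<open>i + 1\<close> is a variable times one of degree
  \<open>i\<close>. This is the obstruction that later rules out a first difference with an inner
  zero.\<close>

lemma hilbert_function_Suc_eq_0:
  assumes "hilbert_function r I i = 0"
  shows "hilbert_function r I (Suc i) = 0"
proof (rule hilbert_function_0_if_forms_subset_ideal)
  have I: "Poly_Mapping.single m (k :: 'k) \<in> I" if "m \<in> monoms_deg r (Suc i)" for m k
  proof -
    from that obtain j n where "j < r" "n \<in> monoms_deg r i" "m = Poly_Mapping.single j 1 + n"
      by (rule monoms_deg_Suc)
    moreover from this have "Poly_Mapping.single n k \<in> I"
      using forms_subset_ideal_if_hilbert_function_0[OF assms] by auto
    ultimately have "var j * Poly_Mapping.single n k \<in> I"
      by (intro ideal_mult) auto
    then show ?thesis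
      using \<open>m = _\<close> by (simp add: var_def mult_single)
  qed
  show "forms r (Suc i) \<subseteq> I"
  proof
    fix p :: "'k mpoly" assume "p \<in> forms r (Suc i)"
    then have "Poly_Mapping.keys p \<subseteq> monoms_deg r (Suc i)" by (simp add: mem_forms_iff)
    then show "p \<in> I"
      by (induction p rule: poly_mapping_induct_keys) (auto intro: I ideal_add)
  qed
qed

text \<open>With no nonzero linear form in \<open>I\<close>, the variables stay independent, so the
  entry in degree 1 recovers the number of variables.\<close>

lemma hilbert_function_1:
  assumes "I \<inter> forms r 1 = {0}"
  shows "hilbert_function r I 1 = r"
proof -
  have lookup: "Poly_Mapping.lookup (\<Sum>j<r. const (k j) * var j) m
      = (\<Sum>j<r. if m = Poly_Mapping.single j 1 then k j else 0)" for k m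
    by (auto simp: lookup_sum lookup_const_mult var_def lookup_single when_def intro!: sum.cong)
  have form: "(\<Sum>j<r. const (k j) * var j) \<in> forms r 1" for k :: "nat \<Rightarrow> 'k"
    by (intro sum_in_forms const_mult_in_forms var_in_forms) simp
  obtain ps where "basis_mod ps (forms r 1)" "length ps = card {..<r}"
  proof (rule exists_basis_of_family[of "{..<r}" var "forms r 1"])
    show "\<forall>j\<in>{..<r}. k j = 0" if "(\<Sum>j<r. const (k j) * var j) \<in> I" for k
    proof
      fix j assume "j \<in> {..<r}"
      moreover have "(\<Sum>j<r. const (k j) * var j) = 0" using that form assms by blast
      ultimately show "k j = 0" using lookup[of k "Poly_Mapping.single j 1"] by simp
    qed
    show "\<exists>k. p - (\<Sum>j<r. const (k j) * var j) \<in> I" if p: "p \<in> forms r 1" for p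
    proof -
      have "p = (\<Sum>j<r. const (Poly_Mapping.lookup p (Poly_Mapping.single j 1)) * var j)"
      proof (rule poly_mapping_eqI)
        fix m
        show "Poly_Mapping.lookup p m = Poly_Mapping.lookup
          (\<Sum>j<r. const (Poly_Mapping.lookup p (Poly_Mapping.single j 1)) * var j) m"
        proof (cases "m \<in> monoms_deg r 1")
          case True
          then show ?thesis unfolding lookup monoms_deg_1 by auto
        next
          case False
          then have "Poly_Mapping.lookup p m = 0" "\<forall>j<r. m \<noteq> Poly_Mapping.single j 1"
            using p by (auto simp: mem_forms_iff in_keys_iff single_in_monoms_deg)
          then show ?thesis unfolding lookup by simp
        qed
      qed
      then show ?thesis
        by (intro exI[of _ "\<lambda>j. Poly_Mapping.lookup p (Poly_Mapping.single j 1)"]) simp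
    qed
  qed (auto simp: var_in_forms[simplified])
  then show ?thesis using hilbert_function_eq_length_basis by simp
qed

text \<open>A nonzero class of degree below \<open>e\<close> is not in the socle, which lives in
  degree \<open>e\<close>, so some variable multiplies it to a nonzero class. Repeating this climbs
  to degree \<open>e\<close>.\<close>

lemma exists_dual_form:
  assumes homogeneous: "\<And>p d. p \<in> I \<Longrightarrow> component d p \<in> I"
    and socle: "socle r I \<subseteq> graded_part r I e"
  shows "i \<le> e \<Longrightarrow> p \<in> forms r i \<Longrightarrow> p \<notin> I \<Longrightarrow> \<exists>q\<in>forms r (e - i). p * q \<notin> I"
proof (induction "e - i" arbitrary: i p)
  case 0
  then show ?case using one_in_forms by (intro bexI[of _ 1]) auto
next
  case (Suc d)
  have p: "p \<in> carrier (mpoly_ring r)" using Suc.prems by (simp add: mem_carrier_form)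
  have "\<exists>j<r. p * var j \<notin> I"
  proof (rule ccontr)
    assume "\<not> ?thesis"
    then have "p \<in> annihilator_of_vars r I" using p by (auto simp: annihilator_of_vars_def)
    then have "proj r I p \<in> graded_part r I e" using socle by (auto simp: socle_eq)
    then obtain f where f: "f \<in> forms r e" "p - f \<in> I"
      using p by (auto simp: graded_part_def proj_eq_iff mem_carrier_form)
    have "i \<noteq> e" using Suc.hyps(2) by auto
    \<comment> \<open>The form \<open>f\<close> has degree \<open>e\<close>, different from
      \<open>i\<close>, and contributes nothing in degree \<open>i\<close>; homogeneity then forces
      \<open>p\<close> into \<open>I\<close>.\<close>
    then have "component i (p - f) = p"
      using Suc.prems f(1) component_add[of i "p - f" f]
      by (simp add: component_form[of _ r i] component_form[of _ r e])
    then show False using homogeneous[OF f(2), of i] Suc.prems by simp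
  qed
  then obtain j where j: "j < r" "p * var j \<notin> I" by blast
  have "Suc i \<le> e" "d = e - Suc i" using Suc.hyps(2) by linarith+
  moreover have "p * var j \<in> forms r (Suc i)" using mult_in_forms[OF Suc.prems(2) var_in_forms[OF j(1)]] by simp
  ultimately obtain q where q: "q \<in> forms r (e - Suc i)" "p * var j * q \<notin> I"
    using Suc.hyps(1)[of "Suc i" "p * var j"] \<open>Suc i \<le> e\<close> \<open>d = e - Suc i\<close> j by auto
  have "var j * q \<in> forms r (1 + (e - Suc i))" by (rule mult_in_forms[OF var_in_forms[OF j(1)] q(1)])
  moreover have "1 + (e - Suc i) = e - i" using Suc.hyps(2) by simp
  ultimately show ?case using q(2) by (auto simp: mult.assoc)
qed

text \<open>The multiplication \<open>A\<^sub>i \<times> A\<^sub>e\<^sub>-\<^sub>i \<rightarrow> A\<^sub>e \<cong> k\<close> has no left kernel.\<close>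

lemma hilbert_function_le_dual:
  assumes homogeneous: "\<And>p d. p \<in> I \<Longrightarrow> component d p \<in> I"
    and socle: "socle r I \<subseteq> graded_part r I e"
    and top: "hilbert_function r I e = 1" and i: "i \<le> e"
  shows "hilbert_function r I i \<le> hilbert_function r I (e - i)"
proof -
  obtain ps where ps: "basis_mod ps (forms r i)" by (rule exists_basis_forms)
  obtain qs where qs: "basis_mod qs (forms r (e - i))" by (rule exists_basis_forms)
  obtain ws where ws: "basis_mod ws (forms r e)" by (rule exists_basis_forms)
  have "length ws = 1" using hilbert_function_eq_length_basis[OF ws] top by simp
  then obtain w where w: "ws = [w]" by (cases ws) auto
  have "\<exists>s. f - const s * w \<in> I" if "f \<in> forms r e" for f
    using ws that by (auto simp: w basis_mod_def lincomb_def)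
  \<comment> \<open>The degree \<open>e\<close> part is one-dimensional, and \<open>\<phi>\<close>
    is the coordinate with respect to its basis vector \<open>w\<close>.\<close>
  then obtain \<phi> where \<phi>: "\<And>f. f \<in> forms r e \<Longrightarrow> f - const (\<phi> f) * w \<in> I" by metis
  have p: "ps ! a \<in> forms r i" if "a < length ps" for a
    using ps that nth_mem by (auto simp: basis_mod_def)
  have q: "qs ! b \<in> forms r (e - i)" if "b < length qs" for b
    using qs that nth_mem by (auto simp: basis_mod_def)
  have pq: "ps ! a * qs ! b \<in> forms r e" if "a < length ps" "b < length qs" for a b
    using mult_in_forms[OF p[OF that(1)] q[OF that(2)]] i by simp
  have "length ps \<le> length qs"
  proof (rule ccontr)
    assume "\<not> ?thesis"
    \<comment> \<open>If \<open>ps\<close> were longer than \<open>qs\<close>, the matrix of the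
      pairing would have a nontrivial left kernel vector \<open>k\<close>.\<close>
    then obtain k where k: "\<exists>a\<in>{..<length ps}. k a \<noteq> 0"
      "\<And>b. b \<in> {..<length qs} \<Longrightarrow> (\<Sum>a<length ps. k a * \<phi> (ps ! a * qs ! b)) = 0"
      using exists_nontrivial_relation[of "{..<length qs}" "{..<length ps}" "\<lambda>a b. \<phi> (ps ! a * qs ! b)"]
      by auto
    let ?p = "lincomb k ps"
    have p_form: "?p \<in> forms r i"
      using lincomb_in_subspace[OF subspace_forms] ps by (simp add: basis_mod_def)
    then have p_carr: "?p \<in> carrier (mpoly_ring r)" by (rule mem_carrier_form)
    have p_qs: "?p * qs ! b \<in> I" if b: "b < length qs" for b
    proof -
      have "(\<Sum>a<length ps. const (k a) * (ps ! a * qs ! b - const (\<phi> (ps ! a * qs ! b)) * w)) \<in> I"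
        by (intro ideal_sum ideal_mult \<phi> pq) (use b in auto)
      also have "(\<Sum>a<length ps. const (k a) * (ps ! a * qs ! b - const (\<phi> (ps ! a * qs ! b)) * w))
          = ?p * qs ! b - (\<Sum>a<length ps. const (k a * \<phi> (ps ! a * qs ! b))) * w"
        by (simp add: lincomb_def right_diff_distrib sum_subtractf sum_distrib_right const_mult mult.assoc)
      also have "(\<Sum>a<length ps. const (k a * \<phi> (ps ! a * qs ! b)))
          = const (\<Sum>a<length ps. k a * \<phi> (ps ! a * qs ! b))"
        by (rule poly_mapping_eqI) (simp add: const_def lookup_sum lookup_single when_def)
      also have "\<dots> = 0" using k(2) b by simp
      finally show ?thesis by simp
    qed
    \<comment> \<open>Vanishing against the basis \<open>qs\<close> extends to all forms of degree
      \<open>e - i\<close>, against the existence of a dual form.\<close>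
    have "?p * f \<in> I" if f: "f \<in> forms r (e - i)" for f
    proof -
      obtain l where l: "f - lincomb l qs \<in> I" using qs f by (auto simp: basis_mod_def)
      have "?p * (f - lincomb l qs) + (\<Sum>b<length qs. const (l b) * (?p * qs ! b)) \<in> I"
        by (intro ideal_add ideal_sum ideal_mult l p_carr p_qs) auto
      also have "?p * (f - lincomb l qs) + (\<Sum>b<length qs. const (l b) * (?p * qs ! b)) = ?p * f"
        by (simp add: lincomb_def[of l] right_diff_distrib sum_distrib_left mult.left_commute)
      finally show ?thesis .
    qed
    moreover have "?p \<notin> I" using ps k(1) by (auto simp: basis_mod_def independent_mod_def)
    ultimately show False
      using exists_dual_form[OF homogeneous socle i p_form] by blast
  qed
  then show ?thesis
    using hilbert_function_eq_length_basis[OF ps] hilbert_function_eq_length_basis[OF qs] by simp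
qed

end

section \<open>Consequences for h-vectors\<close>

lemma standard_graded_artinian_proper_ideal:
  assumes "standard_graded_artinian r I"
  shows "proper_ideal r I"
proof (rule proper_ideal.intro)
  interpret ideal I "mpoly_ring r"
    using assms by (auto simp: standard_graded_artinian_def intro: homogeneous_idealD)
  show "ideal I (mpoly_ring r)" by (rule is_ideal)
  show "1 \<notin> I" using assms one_imp_carrier by (auto simp: standard_graded_artinian_def)
qed

text \<open>The duality inequality for \<open>i\<close> and for \<open>e - i\<close> gives both
  directions. The length of \<open>h\<close> identifies \<open>e\<close> as the socle degree, and
  \<open>h ! e = 1\<close> makes the target of the pairing a line.\<close>

lemma gorenstein_h_vector_symmetric:
  assumes h: "gorenstein_h_vector TYPE('k::field) h" and e: "length h = Suc e" and top: "h ! e = 1"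
    and i: "i \<le> e"
  shows "h ! i = h ! (e - i)"
proof -
  from h obtain r and I :: "'k mpoly set" where I: "standard_graded_artinian r I" "gorenstein r I"
    "h = h_vector r I" by (auto simp: gorenstein_h_vector_def)
  interpret proper_ideal r I by (rule standard_graded_artinian_proper_ideal[OF I(1)])
  have deg: "socle_degree r I = e" using e I(3) by (simp add: h_vector_def)
  have h: "h ! j = hilbert_function r I j" if "j \<le> e" for j
    using that deg unfolding I(3) h_vector_def by (subst nth_map) (auto simp del: upt_Suc)
  have "homogeneous_ideal r I" using I(1) by (simp add: standard_graded_artinian_def)
  note le = hilbert_function_le_dual[OF homogeneous_idealD(2)[OF this], of e]
  have "socle r I \<subseteq> graded_part r I e" using I(2) deg by (simp add: gorenstein_def level_def)
  with le[of i] le[of "e - i"] show ?thesis using top i h by simp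
qed

lemma h_vector_2_le:
  assumes h: "is_h_vector TYPE('k::field) h" and "2 < length h"
  shows "h ! 2 \<le> card (monoms_deg (h ! 1) 2)"
proof -
  from h obtain r and I :: "'k mpoly set" where I: "standard_graded_artinian r I" "h = h_vector r I"
    by (auto simp: is_h_vector_def)
  interpret proper_ideal r I by (rule standard_graded_artinian_proper_ideal[OF I(1)])
  have h: "h ! j = hilbert_function r I j" if "j < length h" for j
    using that unfolding I(2) h_vector_def by (simp del: upt_Suc)
  have "h ! 1 = r"
    using hilbert_function_1 I(1) h[of 1] assms(2) by (simp add: standard_graded_artinian_def)
  then show ?thesis using hilbert_function_le_card_monoms[of 2] h[of 2] assms(2) by simp
qed

lemma h_vector_eq_0_Suc:
  assumes h: "is_h_vector TYPE('k::field) h" and "Suc i < length h" "h ! i = 0"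
  shows "h ! Suc i = 0"
proof -
  from h obtain r and I :: "'k mpoly set" where I: "standard_graded_artinian r I" "h = h_vector r I"
    by (auto simp: is_h_vector_def)
  interpret proper_ideal r I by (rule standard_graded_artinian_proper_ideal[OF I(1)])
  have h: "h ! j = hilbert_function r I j" if "j < length h" for j
    using that unfolding I(2) h_vector_def by (simp del: upt_Suc)
  show ?thesis using hilbert_function_Suc_eq_0[of i] h[of i] h[of "Suc i"] assms(2,3) by simp
qed

section \<open>Gorenstein algebras of socle degree at most five\<close>

lemma card_monoms_deg_1: "card (monoms_deg r 1) = r"
  unfolding monoms_deg_1 by (subst card_image) (auto simp: inj_on_def)

text \<open>A quadratic monomial either avoids the last variable or is that variable times one of
  the \<open>Suc m\<close> variables.\<close>

lemma card_monoms_deg_2_Suc: "card (monoms_deg (Suc m) 2) \<le> card (monoms_deg m 2) + Suc m"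
proof -
  have "monoms_deg (Suc m) 2 \<subseteq> monoms_deg m 2 \<union>
      (\<lambda>j. Poly_Mapping.single m 1 + Poly_Mapping.single j 1) ` {..<Suc m}"
  proof
    fix t assume t: "t \<in> monoms_deg (Suc m) 2"
    show "t \<in> monoms_deg m 2 \<union> (\<lambda>j. Poly_Mapping.single m 1 + Poly_Mapping.single j 1) ` {..<Suc m}"
    proof (cases "m \<in> Poly_Mapping.keys t")
      case True
      then obtain n where n: "t = Poly_Mapping.single m 1 + n" by (rule mono_split_var)
      then have "n \<in> monoms_deg (Suc m) 1" using t by (auto simp: monoms_deg_def mono_degree_add)
      then show ?thesis unfolding monoms_deg_1 n by blast
    next
      case False
      then have "Poly_Mapping.keys t \<subseteq> {..<m}" using t by (force simp: monoms_deg_def monoms_def less_Suc_eq)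
      then show ?thesis using t by (simp add: monoms_deg_def monoms_def)
    qed
  qed
  then have "card (monoms_deg (Suc m) 2) \<le> card (monoms_deg m 2 \<union>
      (\<lambda>j. Poly_Mapping.single m 1 + Poly_Mapping.single j 1) ` {..<Suc m})"
    by (intro card_mono) auto
  also have "\<dots> \<le> card (monoms_deg m 2) + card {..<Suc m}"
    by (rule order.trans[OF card_Un_le]) (intro add_left_mono card_image_le, simp)
  finally show ?thesis by simp
qed

text \<open>The monomial 1, all \<open>m\<close> variables and any \<open>n\<close> quadratic
  monomials form an order ideal \<open>D\<close>; it is a basis of the quotient by the monomials
  outside \<open>D\<close>.\<close>

lemma exists_h_vector_length_3:
  assumes n: "n \<le> card (monoms_deg m 2)"
  obtains g where "is_h_vector TYPE('k::field) g"
    "strip_while (\<lambda>x. x = 0) [1, int m, int n] = map int g"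
proof -
  obtain D2 where D2: "D2 \<subseteq> monoms_deg m 2" "card D2 = n"
    using n obtain_subset_with_card_n by metis
  define D where "D = {0} \<union> monoms_deg m 1 \<union> D2"
  \<comment> \<open>Labelling the monomials of \<open>D\<close> by themselves and all others by the
    zero label makes the class ideal a monomial ideal.\<close>
  define c where "c t = (if t \<in> D then Some t else None)" for t
  \<comment> \<open>The last degree with a nonzero entry, matching the removal of trailing
    zeros.\<close>
  define e :: nat where "e = (if n > 0 then 2 else if m > 0 then 1 else 0)"
  have finD2: "finite D2" by (rule finite_subset[OF D2(1) finite_monoms_deg])
  have deg_le: "mono_degree t \<le> e" if "t \<in> D" for t
    using that D2 finD2 monoms_deg_1[of 0]
    by (auto simp: D_def e_def monoms_deg_def card_eq_0_iff monoms_def)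
  \<comment> \<open>Everything of degree at most 1 belongs to \<open>D\<close>, and a divisor of
    degree 2 of an element of \<open>D\<close> is that element itself.\<close>
  have closed: "t \<in> D" if "t \<in> monoms m" "t + u \<in> D" for t u
  proof (cases "mono_degree t \<le> 1")
    case True
    then have "mono_degree t = 0 \<or> mono_degree t = 1" by linarith
    then show ?thesis using that(1) by (auto simp: D_def monoms_deg_def)
  next
    case False
    have "mono_degree (t + u) \<le> 2" using deg_le[OF that(2)] by (auto simp: e_def split: if_splits)
    then have "mono_degree u = 0" using False mono_degree_add[of t u] by linarith
    then show ?thesis using that(2) by simp
  qed
  interpret monomial_classes m c None e
  proof
    show "c t = None" if "t \<in> monoms m" "e < mono_degree t" for t
      using that deg_le[of t] by (auto simp: c_def)
    show "c (t + u) = None" if "t \<in> monoms m" "u \<in> monoms m" "c t = None" for t u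
      using that closed[of t u] by (auto simp: c_def split: if_splits)
    show "c (t + u) = c (t' + u)" if "t \<in> monoms m" "t' \<in> monoms m" "u \<in> monoms m" "c t = c t'" for t t' u
      using that closed[of t u] closed[of t' u] by (auto simp: c_def split: if_splits)
  qed (auto simp: c_def D_def single_in_monoms_deg[simplified] split: if_splits)
  have img: "c ` monoms_deg m i - {None} = Some ` (monoms_deg m i \<inter> D)" for i
    by (auto simp: c_def)
  have card: "card (c ` monoms_deg m i - {None}) = card (monoms_deg m i \<inter> D)" for i
    unfolding img by (rule card_image) simp
  have parts: "monoms_deg m 0 \<inter> D = {0}" "monoms_deg m 1 \<inter> D = monoms_deg m 1" "monoms_deg m 2 \<inter> D = D2"
    using D2(1) by (auto simp: D_def monoms_deg_def)
  have ex: "\<exists>t\<in>monoms_deg m e. c t \<noteq> None"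
  proof -
    have "card (monoms_deg m e \<inter> D) \<noteq> 0"
      using parts D2(2) card_monoms_deg_1[of m] by (auto simp: e_def)
    then show ?thesis by (auto simp: c_def card_eq_0_iff)
  qed
  then obtain t where t: "t \<in> monoms_deg m e" "c t \<noteq> None" by blast
  have hv: "h_vector m (class_ideal m c None :: 'k mpoly set) = map (\<lambda>i. card (monoms_deg m i \<inter> D)) [0..<Suc e]"
    using h_vector_class_ideal[OF t] by (simp add: card)
  let ?g = "map (\<lambda>i. card (monoms_deg m i \<inter> D)) [0..<Suc e]"
  show thesis
  proof (rule that)
    show "is_h_vector TYPE('k) ?g"
      unfolding is_h_vector_def hv[symmetric] using standard_graded_artinian_class_ideal by blast
    have "monoms_deg 0 2 = {}" by (auto simp: monoms_deg_def monoms_def)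
    with n have "m = 0 \<Longrightarrow> n = 0" by auto
    moreover have "[0..<3] = [0, 1, 2 :: nat]" "[0..<2] = [0, 1 :: nat]" by (simp_all add: upt_rec)
    ultimately show "strip_while (\<lambda>x. x = 0) [1, int m, int n] = map int ?g"
      using parts D2(2) card_monoms_deg_1[of m]
      by (auto simp: e_def strip_while_def)
  qed
qed

lemma SI_sequence_if_socle_degree_le_5:
  assumes e: "0 < e" "e \<le> 5" and h: "length h = Suc e" "h ! 0 = 1" "h ! e = 1"
    and gor: "gorenstein_h_vector TYPE('k::field) h" and uni: "unimodal_seq h"
  shows "SI_sequence TYPE('k) h"
proof -
  note sym = gorenstein_h_vector_symmetric[OF gor h(1,3)]
  have "symmetric_seq h"
    unfolding symmetric_seq_def
  proof (intro allI impI)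
    fix i assume "i < length h"
    then show "h ! i = h ! (length h - 1 - i)" using sym[of i] h(1) by simp
  qed
  have hv: "is_h_vector TYPE('k) h"
    using gor by (auto simp: gorenstein_h_vector_def is_h_vector_def)
  have uni': "\<not> h ! j < h ! Suc j" if "i < j" "Suc j \<le> e" "h ! i > h ! Suc i" for i j
    using uni that h(1) by (auto simp: unimodal_seq_def)
  \<comment> \<open>Comparing only after trailing zeros are stripped lets \<open>n = 0\<close> and
    \<open>m = n = 0\<close> cover the halves of length two and one.\<close>
  have diff: "differentiable_seq TYPE('k) l"
    if "strip_while (\<lambda>x. x = 0) (first_difference l) = strip_while (\<lambda>x. x = 0) [1, int m, int n]"
      "n \<le> card (monoms_deg m 2)" for l m n
    using exists_h_vector_length_3[OF that(2), where 'k = 'k] that(1)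
    unfolding differentiable_seq_def by metis
  \<comment> \<open>If \<open>h ! 1\<close> were zero, the initial drop from 1 would be mirrored by
    a rise in the last step, against unimodality.\<close>
  have h1: "1 \<le> h ! 1" if "2 \<le> e"
    using uni'[of 0 "e - 1"] sym[of 1] that h(2,3) by (cases "h ! 1 = 0") auto
  \<comment> \<open>A drop from index 1 to 2 would be mirrored by a rise from \<open>e - 2\<close>
    to \<open>e - 1\<close>. For \<open>4 \<le> e\<close> that rise comes strictly later.\<close>
  have h2: "h ! 1 \<le> h ! 2" if "4 \<le> e"
  proof (rule ccontr)
    assume "\<not> ?thesis"
    moreover have "Suc (e - 2) = e - 1" "1 < e - 2" using that by auto
    ultimately show False
      using uni'[of 1 "e - 2"] sym[of 1] sym[of 2] that by (simp add: numeral_2_eq_2)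
  qed
  consider "e = 1" | "e div 2 = 1" "2 \<le> e" | "e div 2 = 2" "4 \<le> e" using e by linarith
  then have "differentiable_seq TYPE('k) (take (Suc (e div 2)) h)"
  proof cases
    case 1
    then have "take (Suc (e div 2)) h = [1]" using h by (cases h) auto
    then show ?thesis using diff[of "[1]" 0 0] by (simp add: first_difference_def strip_while_def)
  next
    case 2
    have "take (Suc (e div 2)) h = [1, h ! 1]"
      using 2 h by (intro nth_equalityI) (auto simp: less_Suc_eq)
    moreover have "first_difference [1, h ! 1] = [1, int (h ! 1 - 1)]"
      using h1 2 by (simp add: first_difference_def upt_rec of_nat_diff)
    ultimately show ?thesis
      using diff[of "[1, h ! 1]" "h ! 1 - 1" 0] by (simp add: strip_while_def)
  next
    case 3
    have "take (Suc (e div 2)) h = [1, h ! 1, h ! 2]"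
      using 3 h by (intro nth_equalityI) (auto simp: less_Suc_eq numeral_2_eq_2)
    moreover have "first_difference [1, h ! 1, h ! 2] = [1, int (h ! 1 - 1), int (h ! 2 - h ! 1)]"
      using h1 h2 3 by (simp add: first_difference_def upt_rec of_nat_diff)
    moreover have "h ! 2 - h ! 1 \<le> card (monoms_deg (h ! 1 - 1) 2)"
    proof -
      have "h ! 2 \<le> card (monoms_deg (h ! 1) 2)"
        by (rule h_vector_2_le[OF hv]) (use 3 h in simp)
      also have "\<dots> \<le> card (monoms_deg (h ! 1 - 1) 2) + h ! 1"
        using card_monoms_deg_2_Suc[of "h ! 1 - 1"] h1 3 by simp
      finally show ?thesis by simp
    qed
    ultimately show ?thesis
      using diff[of "[1, h ! 1, h ! 2]" "h ! 1 - 1" "h ! 2 - h ! 1"] by simp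
  qed
  with \<open>symmetric_seq h\<close> show ?thesis by (simp add: SI_sequence_def h)
qed

section \<open>Trivial extensions of monomial level algebras\<close>

text \<open>
  For a pure order ideal \<open>D\<close> of monomials with top-degree part \<open>M\<close>, adjoin one new variable
  \<open>y\<^sub>m\<close> for every \<open>m \<in> M\<close>. The algebra constructed below is the one with Macaulay inverse
  system \<open>F = \<Sum>\<^bsub>m\<in>M\<^esub> m y\<^sub>m\<close>: two monomials are identified iff they contract \<open>F\<close> to the
  same polynomial, and the class of a monomial is represented by the set of monomials of that
  polynomial.
\<close>

locale pure_order_ideal =
  fixes s d :: nat and D :: "(nat \<Rightarrow>\<^sub>0 nat) set" and f :: "(nat \<Rightarrow>\<^sub>0 nat) \<Rightarrow> nat" and M
  defines "M \<equiv> {m \<in> D. mono_degree m = d}"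
  assumes D_subset: "D \<subseteq> monoms s"
    and D_closed: "m + n \<in> D \<Longrightarrow> m \<in> D"
    and D_pure: "m \<in> D \<Longrightarrow> \<exists>n. m + n \<in> M"
    and D_var: "j < s \<Longrightarrow> Poly_Mapping.single j 1 \<in> D"
    and zero_in_D: "0 \<in> D"
    and bij: "bij_betw f M {..<card M}"
begin

abbreviation "r \<equiv> s + card M"
abbreviation "e \<equiv> Suc d"

text \<open>The bijection \<open>f\<close> numbers the new variables, whose indices follow those of
  the \<open>s\<close> old ones.\<close>

definition y :: "(nat \<Rightarrow>\<^sub>0 nat) \<Rightarrow> (nat \<Rightarrow>\<^sub>0 nat)" where
  "y m = Poly_Mapping.single (s + f m) 1"

text \<open>The monomials of the dual form \<open>F\<close>.\<close>

definition S :: "(nat \<Rightarrow>\<^sub>0 nat) set" where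
  "S = (\<lambda>m. m + y m) ` M"

text \<open>Contracting \<open>F\<close> by \<open>t\<close> leaves exactly these monomials, each
  with coefficient 1. The empty set is the label of the monomials that annihilate
  \<open>F\<close>.\<close>

definition c :: "(nat \<Rightarrow>\<^sub>0 nat) \<Rightarrow> (nat \<Rightarrow>\<^sub>0 nat) set" where
  "c t = {n \<in> monoms r. t + n \<in> S}"

lemma M_subset: "M \<subseteq> D"
  by (auto simp: M_def)

lemma monoms_s_subset: "monoms s \<subseteq> monoms r"
  by (force simp: monoms_def)

lemma M_in_monoms: "m \<in> M \<Longrightarrow> m \<in> monoms s" "m \<in> M \<Longrightarrow> m \<in> monoms r"
  using M_subset D_subset monoms_s_subset by blast+

lemma y_in_monoms: "m \<in> M \<Longrightarrow> y m \<in> monoms r"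
  using bij by (auto simp: y_def bij_betw_def monoms_def)

lemma y_notin_monoms_s [simp]: "y m \<notin> monoms s"
  by (simp add: y_def monoms_def)

lemma degree_y [simp]: "mono_degree (y m) = 1"
  by (simp add: y_def)

lemma y_inj: "m \<in> M \<Longrightarrow> m' \<in> M \<Longrightarrow> y m = y m' \<Longrightarrow> m = m'"
  using bij by (auto simp: y_def bij_betw_def inj_on_def)

lemma degree_S: "w \<in> S \<Longrightarrow> mono_degree w = e"
  by (auto simp: S_def M_def mono_degree_add)

lemma S_subset: "S \<subseteq> monoms r"
  using M_in_monoms y_in_monoms by (auto simp: S_def)

lemma S_disjoint: "w \<in> S \<Longrightarrow> w \<notin> monoms s"
  by (auto simp: S_def)

lemma in_S: "t + n \<in> M \<Longrightarrow> t + (n + y (t + n)) \<in> S"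
  unfolding S_def by (rule image_eqI[of _ _ "t + n"]) (simp_all add: add.assoc)

text \<open>A monomial of \<open>F\<close> contains just one new variable, to the first power, so
  only one factor of a product in \<open>S\<close> can contain it.\<close>

lemma S_split: "t + n \<in> S \<Longrightarrow> t \<in> monoms s \<or> n \<in> monoms s"
proof -
  assume "t + n \<in> S"
  then obtain m where m: "m \<in> M" "t + n = m + y m" by (auto simp: S_def)
  then have ms: "m \<in> monoms s" using M_subset D_subset by blast
  have "s + f m \<in> Poly_Mapping.keys (t + n)" unfolding m(2) by (simp add: keys_add_nat y_def)
  then consider "s + f m \<in> Poly_Mapping.keys t" | "s + f m \<in> Poly_Mapping.keys n"
    by (auto simp: keys_add_nat)
  then show ?thesis
  proof cases
    case 1
    then obtain t' where "t = y m + t'" unfolding y_def by (rule mono_split_var)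
    with m(2) have "(t' + n) + y m = m + y m" by (simp add: ac_simps)
    then have "t' + n = m" by simp
    with ms show ?thesis by auto
  next
    case 2
    then obtain n' where "n = y m + n'" unfolding y_def by (rule mono_split_var)
    with m(2) have "(t + n') + y m = m + y m" by (simp add: ac_simps)
    then have "t + n' = m" by simp
    with ms show ?thesis by auto
  qed
qed

lemma S_elim:
  assumes "t \<in> monoms s" "t + n \<in> S"
  obtains n' where "n = n' + y (t + n')" "t + n' \<in> M"
proof -
  from assms(2) obtain m where m: "m \<in> M" "t + n = m + y m" by (auto simp: S_def)
  have "s + f m \<in> Poly_Mapping.keys (t + n)" unfolding m(2) by (simp add: keys_add_nat y_def)
  then have "s + f m \<in> Poly_Mapping.keys n"
    using assms(1) by (auto simp: keys_add_nat monoms_def)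
  then obtain n' where n': "n = y m + n'" unfolding y_def by (rule mono_split_var)
  with m(2) have "(t + n') + y m = m + y m" by (simp add: ac_simps)
    then have "t + n' = m" by simp
  with n' m(1) that[of n'] show thesis by (simp add: add.commute)
qed

text \<open>The cofactor \<open>n\<close> contains the new variable belonging to some
  \<open>m\<close>, hence determines \<open>m\<close> and its own old part \<open>n'\<close>. The
  factor \<open>t\<close> is then \<open>m\<close> divided by \<open>n'\<close>.\<close>

lemma S_cancel:
  assumes t: "t \<in> monoms s" "t + n \<in> S" and t': "t' + n \<in> S"
  shows "t' = t"
proof -
  obtain n' where n: "n = n' + y (t + n')" "t + n' \<in> M" using t by (rule S_elim)
  have "n \<notin> monoms s" using n by simp
  then have "t' \<in> monoms s" using S_split[OF t'] by blast
  then obtain n'' where n2: "n = n'' + y (t' + n'')" "t' + n'' \<in> M" using t' by (rule S_elim)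
  have "n' \<in> monoms s" "n'' \<in> monoms s" using n(2) n2(2) M_subset D_subset by auto
  have *: "n' + y (t + n') = n'' + y (t' + n'')" using n(1) n2(1) by simp
  have keys: "s + f m \<in> Poly_Mapping.keys (u + y m)" for m u by (simp add: keys_add_nat y_def)
  \<comment> \<open>Both decompositions of \<open>n\<close> have an old part free of new variables,
    so the index of the new variable must be the same in both.\<close>
  have "s + f (t + n') = s + f (t' + n'')"
    using keys[of "t + n'" n'] \<open>n'' \<in> monoms s\<close> unfolding *
    by (auto simp: keys_add_nat y_def monoms_def)
  then have y: "y (t + n') = y (t' + n'')" by (simp add: y_def)
  with * have "n' = n''" by simp
  with y_inj[OF n(2) n2(2) y] show "t' = t" by simp
qed

text \<open>Two sets \<open>c t\<close> and \<open>c t'\<close> that meet are equal. In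
  \<open>t + n\<close> one factor is free of new variables, and \<open>S_cancel\<close> shows that
  its partner determines it.\<close>

lemma S_difunctional:
  assumes "t + n \<in> S" "t' + n \<in> S" "t + n' \<in> S"
  shows "t' + n' \<in> S"
proof (cases "t \<in> monoms s")
  case True
  then show ?thesis using S_cancel[of t n t'] assms by simp
next
  case False
  then have "n \<in> monoms s" using S_split[OF assms(1)] by blast
  then show ?thesis using S_cancel[of n t n'] assms by (simp add: add.commute)
qed

lemma c_in_S: "w \<in> S \<Longrightarrow> c w = {0}"
proof -
  assume w: "w \<in> S"
  have "n = 0" if "w + n \<in> S" for n
    using degree_S[OF that] degree_S[OF w] by (simp add: mono_degree_add)
  then show ?thesis using w by (auto simp: c_def)
qed

lemma c_D: "t \<in> D \<Longrightarrow> c t \<noteq> {}"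
proof -
  assume t: "t \<in> D"
  then obtain n where n: "t + n \<in> M" using D_pure by blast
  then have "n \<in> monoms r" using M_in_monoms(2)[OF n] by simp
  then have "n + y (t + n) \<in> c t" using in_S[OF n] y_in_monoms[OF n] by (simp add: c_def)
  then show ?thesis by blast
qed

text \<open>The complement \<open>q\<close> contains no new variable, so by \<open>S_cancel\<close>
  it is the only one.\<close>

lemma c_y: "n + q \<in> M \<Longrightarrow> c (n + y (n + q)) = {q}"
proof -
  assume m: "n + q \<in> M"
  then have q: "q \<in> monoms s" using M_subset D_subset by auto
  have 1: "q + (n + y (n + q)) \<in> S" using in_S[of q n] m by (simp add: add.commute)
  have "q' = q" if "n + y (n + q) + q' \<in> S" for q'
    using S_cancel[OF q 1, of q'] that by (simp add: add.commute)
  then show ?thesis using 1 q monoms_s_subset by (auto simp: c_def add.commute)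
qed

sublocale monomial_classes r c "{}" e
proof
  show "c (m + n) = c (m' + n)" if "m \<in> monoms r" "m' \<in> monoms r" "n \<in> monoms r" "c m = c m'" for m m' n
  proof -
    \<comment> \<open>The label of a product \<open>v + n\<close> depends on \<open>v\<close> only
      through \<open>c v\<close>, so equal labels stay equal.\<close>
    have "u \<in> c (v + n) \<longleftrightarrow> u \<in> monoms r \<and> n + u \<in> c v" for u v
      using that(3) by (auto simp: c_def add.assoc)
    then show ?thesis using that(4) by blast
  qed
  show "c (m + n) = {}" if "m \<in> monoms r" "n \<in> monoms r" "c m = {}" for m n
    using that by (auto simp: c_def add.assoc dest: spec[of _ "n + _"])
  show "mono_degree m = mono_degree m'" if "c m = c m'" "c m \<noteq> {}" for m m'
  proof -
    from that obtain n where "n \<in> c m" "n \<in> c m'" by blast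
    then have "mono_degree (m + n) = mono_degree (m' + n)" by (simp add: c_def degree_S)
    then show ?thesis by (simp add: mono_degree_add)
  qed
  show "c m = {}" if "e < mono_degree m" for m
    using that degree_S[of "m + _"] by (auto simp: c_def mono_degree_add)
  show "c 0 \<noteq> {}" by (rule c_D[OF zero_in_D])
  have var_y: "\<exists>m\<in>M. Poly_Mapping.single j 1 = y m" if "j < r" "\<not> j < s" for j
  proof -
    have "j - s \<in> f ` M" using bij that by (auto simp: bij_betw_def)
    then obtain m where "m \<in> M" "j - s = f m" by blast
    moreover from this have "j = s + f m" using that by linarith
    ultimately show ?thesis by (auto simp: y_def)
  qed
  have c_y0: "c (y m) = {m}" if "m \<in> M" for m
    using c_y[of 0 m] that by simp
  show "c (Poly_Mapping.single j 1) \<noteq> {}" if "j < r" for j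
    using var_y[OF that] c_D[OF D_var] c_y0 by (cases "j < s") auto
  show "i = j" if "i < r" "j < r" and eq: "c (Poly_Mapping.single i 1) = c (Poly_Mapping.single j 1)" for i j
  proof -
    \<comment> \<open>An old variable is separated from every other variable by cancelling a common
      complement; two new variables are separated by their labels \<open>{m}\<close>.\<close>
    have aux: "a = b" if "a < s" "c (Poly_Mapping.single a 1) = c (Poly_Mapping.single b 1)" for a b
    proof -
      from c_D[OF D_var[OF that(1)]] obtain n where "n \<in> c (Poly_Mapping.single a 1)" by blast
      with that(2) have "Poly_Mapping.single a 1 + n \<in> S" "Poly_Mapping.single b 1 + n \<in> S"
        by (auto simp: c_def)
      from S_cancel[OF _ this] have "Poly_Mapping.single b (1::nat) = Poly_Mapping.single a 1"
        using that(1) by simp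
      then show "a = b" by (simp only: single_one_eq_iff)
    qed
    have ij: "i < r" "j < r" by (fact that)+
    consider "i < s" | "j < s" | "\<not> i < s" "\<not> j < s" by blast
    then show ?thesis
    proof cases
      case 3
      obtain m where m: "m \<in> M" "Poly_Mapping.single i 1 = y m" using var_y[OF ij(1) 3(1)] by blast
      obtain m' where m': "m' \<in> M" "Poly_Mapping.single j 1 = y m'" using var_y[OF ij(2) 3(2)] by blast
      have "m = m'" using eq c_y0 m m' by simp
      then have "Poly_Mapping.single i (1::nat) = Poly_Mapping.single j 1" using m(2) m'(2) by simp
      then show ?thesis by (simp only: single_one_eq_iff)
    qed (use aux eq in metis)+
  qed
qed

lemma exists_top: obtains w where "w \<in> S" "w \<in> monoms_deg r e"
proof -
  obtain n where "0 + n \<in> M" using D_pure[OF zero_in_D] by blast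
  then have "n + y n \<in> S" by (simp add: S_def)
  then show thesis using that S_subset degree_S by (auto simp: monoms_deg_def)
qed

text \<open>Any complement \<open>d\<close> of \<open>m\<close> can serve as its dual monomial:
  \<open>n + d\<close> lies in \<open>S\<close> iff \<open>c n\<close> contains \<open>d\<close>,
  which by difunctionality means \<open>c n = c m\<close>. It is not 1 because \<open>m\<close> lies
  outside the top class.\<close>

lemma gorenstein: "gorenstein r (class_ideal r c {} :: 'k::field mpoly set)"
proof -
  obtain w where w: "w \<in> S" "w \<in> monoms_deg r e" by (rule exists_top)
  show ?thesis
  proof (rule gorenstein_class_ideal[OF w(2)])
    show "c w \<noteq> {}" using c_in_S[OF w(1)] by simp
  next
    fix m assume m: "m \<in> monoms r" "c m \<noteq> {}" "c m \<noteq> c w"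
    then obtain d where d: "d \<in> c m" by blast
    then have dS: "m + d \<in> S" "d \<in> monoms r" by (auto simp: c_def)
    have top: "c u = c w \<longleftrightarrow> u \<in> S" for u
    proof
      assume "c u = c w"
      then have "0 \<in> c u" using c_in_S[OF w(1)] by simp
      then show "u \<in> S" by (simp add: c_def)
    qed (simp add: c_in_S w(1))
    have "c (d + n) = c w \<longleftrightarrow> c n = c m" if n: "n \<in> monoms r" for n
    proof
      assume "c (d + n) = c w"
      then have n: "n + d \<in> S" using top by (simp add: add.commute)
      show "c n = c m"
        using S_difunctional[OF dS(1) n] S_difunctional[OF n dS(1)] by (auto simp: c_def)
    next
      assume "c n = c m"
      with d have "n + d \<in> S" by (auto simp: c_def)
      then show "c (d + n) = c w" using top by (simp add: add.commute)
    qed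
    moreover have "d \<noteq> 0" using dS m(3) top by auto
    ultimately show "\<exists>d\<in>monoms r. d \<noteq> 0 \<and> (\<forall>n\<in>monoms r. c (d + n) = c w \<longleftrightarrow> c n = c m)"
      using dS(2) by blast
  qed
qed

text \<open>A monomial with nonzero class and only old variables divides some element of
  \<open>M\<close> and lies in \<open>D\<close>. One containing a new variable contracts
  \<open>F\<close> to a single monomial of \<open>D\<close> of complementary degree.\<close>

lemma classes_of_degree:
  assumes i: "0 < i" "i \<le> d"
  shows "c ` monoms_deg r i - {{}} = c ` (D \<inter> monoms_deg s i) \<union> (\<lambda>q. {q}) ` (D \<inter> monoms_deg s (e - i))"
    (is "?L = ?A \<union> ?B")
proof
  show "?L \<subseteq> ?A \<union> ?B"
  proof
    fix a assume "a \<in> ?L"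
    then obtain t n where t: "t \<in> monoms r" "mono_degree t = i" "a = c t" and n: "n \<in> c t"
      by (auto simp: monoms_deg_def)
    then have tn: "t + n \<in> S" by (simp add: c_def)
    show "a \<in> ?A \<union> ?B"
    proof (cases "t \<in> monoms s")
      case True
      then obtain n' where "t + n' \<in> M" using tn by (rule S_elim)
      then have "t \<in> D" using M_subset D_closed by blast
      then show ?thesis using True t by (auto simp: monoms_deg_def)
    next
      case False
      then have ns: "n \<in> monoms s" using S_split[OF tn] by blast
      moreover have "n + t \<in> S" using tn by (simp add: add.commute)
      ultimately obtain t' where t': "t = t' + y (n + t')" "n + t' \<in> M" by (rule S_elim)
      then have "c t = {n}" using c_y[of t' n] by (simp add: add.commute)
      moreover have "n \<in> D" using t' M_subset D_closed by blast
      moreover have "mono_degree n = e - i"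
        using degree_S[OF tn] t(2) by (simp add: mono_degree_add)
      ultimately show ?thesis using t(3) ns by (auto simp: monoms_deg_def)
    qed
  qed
  show "?A \<union> ?B \<subseteq> ?L"
  proof
    fix a assume "a \<in> ?A \<union> ?B"
    then show "a \<in> ?L"
    proof
      assume "a \<in> ?A"
      then show ?thesis using c_D monoms_s_subset by (auto simp: monoms_deg_def)
    next
      assume "a \<in> ?B"
      then obtain q where q: "a = {q}" "q \<in> D" "mono_degree q = e - i" by (auto simp: monoms_deg_def)
      \<comment> \<open>Purity completes \<open>q\<close> to an element of \<open>M\<close>; the
        completing factor times the new variable of that element contracts \<open>F\<close> to
        \<open>q\<close> alone.\<close>
      obtain n where n: "q + n \<in> M" using D_pure[OF q(2)] by blast
      then have "n \<in> monoms r" using M_in_monoms(2)[OF n] by simp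
      moreover have "mono_degree q + mono_degree n = d" using n by (simp add: M_def mono_degree_add)
      ultimately have "n + y (n + q) \<in> monoms_deg r i"
        using q(3) i y_in_monoms[OF n] by (auto simp: monoms_deg_def mono_degree_add add.commute)
      moreover have "c (n + y (n + q)) = a" using c_y[of n q] n q(1) by (simp add: add.commute)
      ultimately show ?thesis using q(1) by (auto simp: image_iff intro!: bexI[of _ "n + y (n + q)"])
    qed
  qed
qed

text \<open>Classes of old monomials are distinct by \<open>S_cancel\<close>. None of them contains
  a complement \<open>q\<close> in old variables, since every element of \<open>S\<close> involves a
  new variable; so the two families are disjoint.\<close>

lemma card_classes_of_degree:
  assumes i: "0 < i" "i \<le> d"
  shows "card (c ` monoms_deg r i - {{}}) = card (D \<inter> monoms_deg s i) + card (D \<inter> monoms_deg s (e - i))"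
proof -
  have inj: "inj_on c (D \<inter> monoms_deg s i)"
  proof (rule inj_onI)
    fix t t' assume t: "t \<in> D \<inter> monoms_deg s i" "t' \<in> D \<inter> monoms_deg s i" "c t = c t'"
    then obtain n where "n \<in> c t" "n \<in> c t'" using c_D[of t] by blast
    then show "t = t'" using S_cancel[of t' n t] t by (auto simp: c_def monoms_deg_def)
  qed
  have "c ` (D \<inter> monoms_deg s i) \<inter> (\<lambda>q. {q}) ` (D \<inter> monoms_deg s (e - i)) = {}"
  proof -
    have False if "c t = {q}" "t \<in> monoms s" "q \<in> monoms s" for t q
    proof -
      have "t + q \<in> S" using that(1) by (auto simp: c_def)
      then show False using S_disjoint[of "t + q"] that(2,3) by simp
    qed
    then show ?thesis by (fastforce simp: monoms_deg_def)
  qed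
  then have "card (c ` monoms_deg r i - {{}}) =
      card (c ` (D \<inter> monoms_deg s i)) + card ((\<lambda>q. {q}) ` (D \<inter> monoms_deg s (e - i)))"
    unfolding classes_of_degree[OF i] by (intro card_Un_disjoint) auto
  also have "\<dots> = card (D \<inter> monoms_deg s i) + card (D \<inter> monoms_deg s (e - i))"
    using inj by (simp add: card_image)
  finally show ?thesis .
qed

lemma gorenstein_h_vector:
  "gorenstein_h_vector TYPE('k::field)
    (map (\<lambda>i. if i = 0 \<or> i = e then 1
      else card (D \<inter> monoms_deg s i) + card (D \<inter> monoms_deg s (e - i))) [0..<Suc e])"
    (is "gorenstein_h_vector _ ?h")
proof -
  obtain w where w: "w \<in> S" "w \<in> monoms_deg r e" by (rule exists_top)
  \<comment> \<open>By degree, a monomial of degree \<open>e\<close> with nonzero class lies in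
    \<open>S\<close>, and its only complement is 1, the exponent vector 0.\<close>
  have top: "c ` monoms_deg r e - {{}} = {{0}}"
  proof -
    have "t \<in> S" if "t \<in> monoms_deg r e" "c t \<noteq> {}" for t
    proof -
      from that(2) obtain n where n: "t + n \<in> S" by (auto simp: c_def)
      then have "n = 0" using degree_S[OF n] that(1) by (simp add: monoms_deg_def mono_degree_add)
      then show ?thesis using n by simp
    qed
    then have "c ` monoms_deg r e - {{}} \<subseteq> {{0}}" using c_in_S by blast
    moreover have "{0} \<in> c ` monoms_deg r e"
      using c_in_S[OF w(1)] by (rule image_eqI[OF sym w(2)])
    ultimately show ?thesis by blast
  qed
  have "h_vector r (class_ideal r c {} :: 'k mpoly set) = ?h"
  proof (subst h_vector_class_ideal[OF w(2)])
    show "c w \<noteq> {}" using c_in_S[OF w(1)] by simp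
    show "map (\<lambda>i. card (c ` monoms_deg r i - {{}})) [0..<Suc e] = ?h"
    proof (rule map_cong[OF refl])
      fix i assume "i \<in> set [0..<Suc e]"
      then consider "i = 0" | "i = e" | "0 < i" "i \<le> d" by (fastforce simp del: upt_Suc)
      then show "card (c ` monoms_deg r i - {{}}) = (if i = 0 \<or> i = e then 1
          else card (D \<inter> monoms_deg s i) + card (D \<inter> monoms_deg s (e - i)))"
      proof cases
        case 1
        then show ?thesis using c_0 by simp
      next
        case 2
        then show ?thesis using top by simp
      next
        case 3
        then show ?thesis using card_classes_of_degree[of i] by simp
      qed
    qed
  qed
  then show ?thesis
    unfolding gorenstein_h_vector_def using gorenstein standard_graded_artinian_class_ideal by metis
qed

end

section \<open>A unimodal Gorenstein $h$-vector that is not an SI-sequence\<close>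

definition threefold :: "nat \<Rightarrow> nat \<Rightarrow> nat \<Rightarrow> (nat \<Rightarrow>\<^sub>0 nat)" where
  "threefold a b c = Poly_Mapping.single 0 a + Poly_Mapping.single 1 b + Poly_Mapping.single 2 c"

lemma lookup_threefold:
  "Poly_Mapping.lookup (threefold a b c) j = (if j = 0 then a else if j = 1 then b else if j = 2 then c else 0)"
  by (auto simp: threefold_def lookup_add lookup_single when_def)

lemma threefold_in_monoms: "threefold a b c \<in> monoms 3"
  by (simp add: threefold_def)

lemma mono_degree_threefold: "mono_degree (threefold a b c) = a + b + c"
  by (simp add: threefold_def mono_degree_add)

lemma monoms_3_eq_threefold:
  assumes "m \<in> monoms 3"
  shows "m = threefold (Poly_Mapping.lookup m 0) (Poly_Mapping.lookup m 1) (Poly_Mapping.lookup m 2)"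
proof (rule poly_mapping_eqI)
  fix j
  have "Poly_Mapping.lookup m j = 0" if "3 \<le> j"
    using assms that by (auto simp: monoms_def in_keys_iff)
  then show "Poly_Mapping.lookup m j = Poly_Mapping.lookup
      (threefold (Poly_Mapping.lookup m 0) (Poly_Mapping.lookup m 1) (Poly_Mapping.lookup m 2)) j"
    unfolding lookup_threefold by (cases "3 \<le> j") (auto simp: not_le numeral_3_eq_3 numeral_2_eq_2 less_Suc_eq)
qed

text \<open>For \<open>d = e - 1\<close> with \<open>6 \<le> e\<close>, and \<open>x\<close>,
  \<open>y\<close>, \<open>z\<close> the variables 0, 1, 2, this is the order ideal \<open>D\<close>
  of the opening comment, described by exponents instead of generators.\<close>

definition capped :: "nat \<Rightarrow> (nat \<Rightarrow>\<^sub>0 nat) set" where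
  "capped d = {m \<in> monoms 3. mono_degree m \<le> d \<and>
     (Poly_Mapping.lookup m 2 \<le> 2 \<or> Poly_Mapping.lookup m 2 = 3 \<and> Poly_Mapping.lookup m 1 = 0)}"

text \<open>In a fixed degree the exponent of \<open>x\<close> is determined by the other two, and
  these are counted instead.\<close>

lemma card_capped:
  assumes "i \<le> d"
  shows "card (capped d \<inter> monoms_deg 3 i) = card {(b, c). b + c \<le> i \<and> (c \<le> 2 \<or> c = 3 \<and> b = 0)}"
    (is "_ = card ?P")
proof -
  let ?g = "\<lambda>(b, c). threefold (i - b - c) b c"
  have "inj_on ?g ?P"
  proof (rule inj_onI, clarify)
    fix b c b' c' assume "threefold (i - b - c) b c = threefold (i - b' - c') b' c'"
    then have "Poly_Mapping.lookup (threefold (i - b - c) b c) j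
        = Poly_Mapping.lookup (threefold (i - b' - c') b' c') j" for j by simp
    from this[of 1] this[of 2] show "b = b' \<and> c = c'" by (simp add: lookup_threefold)
  qed
  moreover have "capped d \<inter> monoms_deg 3 i = ?g ` ?P"
  proof
    show "?g ` ?P \<subseteq> capped d \<inter> monoms_deg 3 i"
      using assms threefold_in_monoms
      by (auto simp: capped_def monoms_deg_def mono_degree_threefold lookup_threefold)
    show "capped d \<inter> monoms_deg 3 i \<subseteq> ?g ` ?P"
    proof
      fix m assume m: "m \<in> capped d \<inter> monoms_deg 3 i"
      let ?a = "Poly_Mapping.lookup m 0" and ?b = "Poly_Mapping.lookup m 1" and ?c = "Poly_Mapping.lookup m 2"
      have eq: "m = threefold ?a ?b ?c" using m by (intro monoms_3_eq_threefold) (simp add: capped_def)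
      have "i = ?a + ?b + ?c"
        using m mono_degree_threefold[of ?a ?b ?c] eq by (simp add: monoms_deg_def)
      then have "m = ?g (?b, ?c)" "(?b, ?c) \<in> ?P"
        using eq m by (auto simp: capped_def)
      then show "m \<in> ?g ` ?P" by (rule image_eqI)
    qed
  qed
  ultimately show ?thesis by (simp add: card_image)
qed

text \<open>The values 0, 1, 2 of \<open>c\<close> contribute \<open>i + 1\<close>, \<open>i\<close>
  and \<open>i - 1\<close> pairs; the pair \<open>(0, 3)\<close> joins them from degree 3
  on.\<close>

lemma card_capped_pairs:
  assumes "0 < i"
  shows "card {(b, c). b + c \<le> (i::nat) \<and> (c \<le> 2 \<or> c = 3 \<and> b = 0)} = (if i \<le> 2 then 3 * i else 3 * i + 1)"
\<comment> \<open>Degree 1 is separate because the truncated \<open>i - 2\<close> would add the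
  spurious pair \<open>(0, 2)\<close>.\<close>
proof (cases "i = 1")
  case True
  then have "{(b, c). b + c \<le> i \<and> (c \<le> 2 \<or> c = 3 \<and> b = 0)} = {(0, 0), (1, 0), (0, 1)}"
    by auto
  then show ?thesis using True by simp
next
  case False
  let ?Q = "{..i} \<times> {0} \<union> {..i - 1} \<times> {1} \<union> {..i - 2} \<times> {2::nat}"
  have "{(b, c). b + c \<le> i \<and> (c \<le> 2 \<or> c = 3 \<and> b = 0)} = ?Q \<union> (if i \<le> 2 then {} else {(0, 3)})"
    using assms False by (auto simp: numeral_2_eq_2 le_Suc_eq)
  moreover have "card ?Q = 3 * i"
    using assms False by (subst card_Un_disjoint; (subst card_Un_disjoint)?) auto
  moreover have "card (?Q \<union> {(0, 3)}) = card ?Q + 1"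
    by (subst card_Un_disjoint) auto
  ultimately show ?thesis by auto
qed

lemma pure_order_ideal_capped:
  assumes "0 < d" "bij_betw f {m \<in> capped d. mono_degree m = d} {..<card {m \<in> capped d. mono_degree m = d}}"
  shows "pure_order_ideal 3 d (capped d) f"
proof
  show "capped d \<subseteq> monoms 3" by (auto simp: capped_def)
  show "m \<in> capped d" if "m + n \<in> capped d" for m n
    using that by (auto simp: capped_def lookup_add mono_degree_add)
  \<comment> \<open>A power of \<open>x\<close> fills up the degree without touching the restricted
    exponents.\<close>
  show "\<exists>n. m + n \<in> {m \<in> capped d. mono_degree m = d}" if "m \<in> capped d" for m
    by (rule exI[of _ "Poly_Mapping.single 0 (d - mono_degree m)"])
      (use that in \<open>auto simp: capped_def mono_degree_add lookup_add lookup_single\<close>)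
  show "Poly_Mapping.single j 1 \<in> capped d" if "j < 3" for j
    using that assms(1) by (auto simp: capped_def lookup_single when_def)
  show "0 \<in> capped d" by (simp add: capped_def)
qed (fact assms(2))

section \<open>The counterexample sequence and its properties\<close>

definition non_SI_h_vector :: "nat \<Rightarrow> nat list" where
  "non_SI_h_vector e = map (\<lambda>i. if i = 0 \<or> i = e then 1 else if i \<le> 2 \<or> e \<le> i + 2 then 3 * e + 1 else 3 * e + 2) [0..<Suc e]"

lemma length_non_SI_h_vector [simp]: "length (non_SI_h_vector e) = Suc e"
  by (simp add: non_SI_h_vector_def)

lemma nth_non_SI_h_vector:
  "i \<le> e \<Longrightarrow> non_SI_h_vector e ! i =
    (if i = 0 \<or> i = e then 1 else if i \<le> 2 \<or> e \<le> i + 2 then 3 * e + 1 else 3 * e + 2)"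
  unfolding non_SI_h_vector_def by (subst nth_map) (auto simp del: upt_Suc)

lemma gorenstein_non_SI_h_vector:
  assumes "6 \<le> e"
  shows "gorenstein_h_vector TYPE('k::field) (non_SI_h_vector e)"
proof -
  obtain d where d: "e = Suc d" using assms by (cases e) auto
  let ?M = "{m \<in> capped d. mono_degree m = d}"
  have "finite ?M"
    by (rule finite_subset[OF _ finite_monoms_deg[of 3 d]]) (auto simp: capped_def monoms_deg_def)
  from ex_bij_betw_finite_nat[OF this] obtain f where "bij_betw f ?M {..<card ?M}"
    unfolding atLeast0LessThan by (elim exE)
  then interpret pure_order_ideal 3 d "capped d" f ?M
    using assms d by (intro pure_order_ideal_capped) auto
  have card: "card (capped d \<inter> monoms_deg 3 i) = (if i \<le> 2 then 3 * i else 3 * i + 1)" if "0 < i" "i \<le> d" for i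
    using card_capped[OF that(2)] card_capped_pairs[OF that(1)] by simp
  have "map (\<lambda>i. if i = 0 \<or> i = Suc d then 1
      else card (capped d \<inter> monoms_deg 3 i) + card (capped d \<inter> monoms_deg 3 (Suc d - i))) [0..<Suc (Suc d)]
    = non_SI_h_vector e"
    unfolding non_SI_h_vector_def d
  proof (rule map_cong[OF refl])
    fix i assume "i \<in> set [0..<Suc (Suc d)]"
    then have "i \<le> Suc d" by (simp del: upt_Suc add: less_Suc_eq_le)
    then show "(if i = 0 \<or> i = Suc d then 1
        else card (capped d \<inter> monoms_deg 3 i) + card (capped d \<inter> monoms_deg 3 (Suc d - i)))
      = (if i = 0 \<or> i = Suc d then 1 else if i \<le> 2 \<or> Suc d \<le> i + 2 then 3 * Suc d + 1 else 3 * Suc d + 2)"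
      \<comment> \<open>The linear parts of the two counts add up to \<open>3 * e\<close>, and each
        of \<open>i\<close>, \<open>e - i\<close> that is at least 3 contributes one more. Since
        \<open>6 \<le> e\<close>, at least one of them is.\<close>
      using card[of i] card[of "Suc d - i"] assms d by auto
  qed
  then show ?thesis using gorenstein_h_vector[where 'k = 'k] by metis
qed

lemma unimodal_non_SI_h_vector:
  assumes "6 \<le> e"
  shows "unimodal_seq (non_SI_h_vector e)"
  unfolding unimodal_seq_def
proof (intro allI impI)
  fix i j assume ij: "i < j" "Suc j < length (non_SI_h_vector e)"
    "non_SI_h_vector e ! i > non_SI_h_vector e ! Suc i"
  \<comment> \<open>A strict drop starts no earlier than index \<open>e - 3\<close>, and from there
    on the sequence never rises.\<close>
  then have "e \<le> Suc i + 2"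
    using assms by (auto simp: nth_non_SI_h_vector split: if_splits)
  then show "\<not> non_SI_h_vector e ! j < non_SI_h_vector e ! Suc j"
    using assms ij(1,2) by (auto simp: nth_non_SI_h_vector)
qed

lemma length_first_difference [simp]: "length (first_difference h) = length h"
  by (simp add: first_difference_def)

lemma nth_first_difference:
  "i < length h \<Longrightarrow> first_difference h ! i = (if i = 0 then int (h ! 0) else int (h ! i) - int (h ! (i - 1)))"
  by (simp add: first_difference_def)

lemma not_SI_non_SI_h_vector:
  assumes "6 \<le> e"
  shows "\<not> SI_sequence TYPE('k::field) (non_SI_h_vector e)"
proof
  let ?l = "take (Suc (e div 2)) (non_SI_h_vector e)"
  assume "SI_sequence TYPE('k) (non_SI_h_vector e)"
  then obtain g where g: "is_h_vector TYPE('k) g"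
    "strip_while (\<lambda>x. x = 0) (first_difference ?l) = map int g"
    by (auto simp: SI_sequence_def differentiable_seq_def)
  \<comment> \<open>Reading entries with default 0 ignores trailing zeros, so entries 2 and 3 are
    available before the length of \<open>g\<close> is known.\<close>
  have "(\<lambda>x::int. x = 0) = (=) 0" by auto
  with g(2) have "nth_default 0 (map int g) = nth_default 0 (first_difference ?l)"
    using nth_default_strip_while_dflt[of 0 "first_difference ?l"] by simp
  \<comment> \<open>For \<open>6 \<le> e\<close> index 3 still belongs to the first half. The entry
    1 found there shows that \<open>g\<close> reaches degree 3, although it vanishes in degree
    2.\<close>
  moreover have "nth_default 0 (first_difference ?l) 2 = 0" "nth_default 0 (first_difference ?l) 3 = 1"
    using assms by (auto simp: nth_default_def nth_first_difference nth_non_SI_h_vector)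
  ultimately have "nth_default 0 (map int g) 2 = 0" "nth_default 0 (map int g) 3 = 1" by simp_all
  then have "3 < length g" "g ! 2 = 0" "g ! 3 = 1"
    by (auto simp: nth_default_def split: if_splits)
  then show False using h_vector_eq_0_Suc[OF g(1), of 2] by simp
qed

theorem theorem3p1:
  fixes e :: nat
  assumes "infinite (UNIV :: 'k::field set)" and "e > 0"
  shows "(\<exists>h :: nat list. length h = Suc e \<and> h ! 0 = 1 \<and> h ! e = 1 \<and>
            gorenstein_h_vector TYPE('k) h \<and> unimodal_seq h \<and> \<not> SI_sequence TYPE('k) h)
         \<longleftrightarrow> e \<ge> 6"
proof
  assume "\<exists>h :: nat list. length h = Suc e \<and> h ! 0 = 1 \<and> h ! e = 1 \<and>
    gorenstein_h_vector TYPE('k) h \<and> unimodal_seq h \<and> \<not> SI_sequence TYPE('k) h"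
  then show "e \<ge> 6"
    using SI_sequence_if_socle_degree_le_5[OF \<open>e > 0\<close>, where 'k = 'k] by (cases "e \<le> 5") auto
next
  assume e: "e \<ge> 6"
  show "\<exists>h :: nat list. length h = Suc e \<and> h ! 0 = 1 \<and> h ! e = 1 \<and>
    gorenstein_h_vector TYPE('k) h \<and> unimodal_seq h \<and> \<not> SI_sequence TYPE('k) h"
    using gorenstein_non_SI_h_vector[OF e] unimodal_non_SI_h_vector[OF e] not_SI_non_SI_h_vector[OF e]
    by (intro exI[of _ "non_SI_h_vector e"]) (simp add: nth_non_SI_h_vector)
qed

end
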